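(* Let $N$ be a nanotube that has a perfect matching, and let $L$ be a cut segment of $N$. Two perfect matchings $M_1,M_2$ of $N$ lie in the same connected component of the resonance graph $R_6(N)$ if and only if ${\rm flow}_L(N,M_1)={\rm flow}_L(N,M_2)$ and $M_1$ and $M_2$ have precisely the same ladders.
   Context: Nanotube: take the hexagonal lattice in the plane with basic lattice vectors $\vec a_1,\vec a_2$ (generating its translation lattice), a lattice point $O$, and integers $(a,b)\neq(0,0)$; let $\overrightarrow{OA}=a\vec a_1+b\vec a_2$, and let $l_1,l_2$ be the lines through $O$ and $A$ perpendicular to $\overrightarrow{OA}$. Identifying $l_1$ with $l_2$ by the translation taking $O$ to $A$ gives a hexagonal tessellation $\widetilde H$ of an infinite cylinder, with axis parallel to $l_1$. A nanotube $N$ is the finite subgraph of $\widetilde H$ lying between (and including) two vertex-disjoint cycles $C_1,C_2$ of $\widetilde H$ of length at least $4$ that encircle the axis; $C_1,C_2$ are its two open-ends. $N$ is a bipartite graph with a fixed proper black/white vertex colouring. It is drawn in the plane so that one open-end bounds a hole face, the other bounds the exterior face, and all other faces are hexagons. Resonance graph: $R_6(N)$ has the perfect matchings of $N$ as vertices, and two of them are adjacent iff their symmetric difference is exactly the set of six edges of a hexagon (hexagonal face of the tessellation) of $N$. Cut segment and flow: the dual graph of the plane drawing has one vertex per face (including the hole and the exterior face) and one dual edge $e^*$ for each edge $e$, joining the two faces on the sides of $e$ and crossing only $e$. A cut segment $L$ is a directed path in the dual graph whose two end vertices are the faces corresponding to the two open-ends. Let $L^*$ be the set of edges of $N$ crossed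 by $L$, and let $(L^* )^+$ (resp. $(L^* )^-$) be the set of $e\in L^*$ whose white end-vertex is on the left (resp. right) side of $L$. For a perfect matching $M$, ${\rm flow}_L(N,M)=|(L^* )^+\cap M|-|(L^* )^-\cap M|$. Ladders: the edges of the hexagonal lattice, hence of $N$, have three edge-directions (parallel classes). A zigzag cycle is a cycle whose edges have only two edge-directions, appearing alternately along the cycle. A ladder of a perfect matching $M$ is a zigzag cycle $Z$ that is $M$-alternating (its edges are alternately in $M$ and not in $M$). A ladder is considered together with its matching edges: $M_1,M_2$ have precisely the same ladders if, for every zigzag cycle $Z$, $Z$ is $M_1$-alternating iff it is $M_2$-alternating, and in that case $M_1\cap E(Z)=M_2\cap E(Z)$. *)

theory Defs
  imports Main
begin

section \<open>The hexagonal lattice\<close>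

text \<open>
  Fix basic lattice vectors \<open>a1\<close>, \<open>a2\<close> of equal length at an angle of 60 degrees, with \<open>a2\<close> anticlockwise
  from \<open>a1\<close>. The hexagons are centred at the points \<open>i a1 + j a2\<close>, and the hexagon is identified with
  its centre \<open>(i, j)\<close>. There are two lattice vertices per translation cell,
  \<open>Up i j = (i + 1/3) a1 + (j + 1/3) a2\<close> and \<open>Dn i j = (i + 2/3) a1 + (j + 2/3) a2\<close>.
\<close>

datatype hvert = Up int int | Dn int int

type_synonym cell = "int \<times> int"

text \<open>
  The six corners of a hexagon are numbered anticlockwise (indices modulo 6). Side \<open>k\<close> joins the
  corners \<open>k\<close> and \<open>k + 1\<close>, and \<open>nbr p k\<close> is the hexagon across side \<open>k\<close> of \<open>p\<close>.
\<close>

fun corner :: "cell \<Rightarrow> nat \<Rightarrow> hvert" where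
  "corner (i, j) k =
     [Up i j, Dn (i - 1) j, Up (i - 1) j, Dn (i - 1) (j - 1), Up i (j - 1), Dn i (j - 1)] ! (k mod 6)"

fun nbr :: "cell \<Rightarrow> nat \<Rightarrow> cell" where
  "nbr (i, j) k =
     [(i, j + 1), (i - 1, j + 1), (i - 1, j), (i, j - 1), (i + 1, j - 1), (i + 1, j)] ! (k mod 6)"

definition side :: "cell \<Rightarrow> nat \<Rightarrow> hvert set" where
  "side p k = {corner p k, corner p (Suc k)}"

lemma side_nbr: "side (nbr p k) (k + 3) = side p k"
proof -
  obtain i j where p: "p = (i, j)" by fastforce
  have "k mod 6 < 6" by simp
  then consider "k mod 6 = 0" | "k mod 6 = 1" | "k mod 6 = 2" | "k mod 6 = 3" | "k mod 6 = 4"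
    | "k mod 6 = 5" by linarith
  moreover have "(k + 3) mod 6 = (k mod 6 + 3) mod 6" "Suc k mod 6 = Suc (k mod 6) mod 6"
    "Suc (k + 3) mod 6 = (k mod 6 + 4) mod 6" by presburger+
  ultimately show ?thesis
    unfolding p side_def by cases (simp_all add: insert_commute)
qed


section \<open>The hexagonal tessellation of the cylinder\<close>

text \<open>
  The strip between \<open>l1\<close> and \<open>l2\<close> with its boundary lines identified is the quotient of the plane by
  the translations by multiples of \<open>a a1 + b a2\<close>. Vertices and hexagons of the cylinder are the
  orbits of lattice vertices and hexagons; an edge is the set of its two end-vertices. Two distinct
  edges have the same end-vertices only if \<open>(a, b)\<close> is one of the six shortest translations, and
  for these there is no cycle of length at least 3, hence no nanotube.
\<close>

type_synonym tvert = "hvert set"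
type_synonym tedge = "tvert set"
type_synonym tcell = "cell set"

fun shift :: "int \<Rightarrow> int \<Rightarrow> hvert \<Rightarrow> hvert" where
  "shift x y (Up i j) = Up (i + x) (j + y)"
| "shift x y (Dn i j) = Dn (i + x) (j + y)"

definition tv :: "int \<Rightarrow> int \<Rightarrow> hvert \<Rightarrow> tvert" where
  "tv a b v = {shift (n * a) (n * b) v |n. True}"

definition tc :: "int \<Rightarrow> int \<Rightarrow> cell \<Rightarrow> tcell" where
  "tc a b p = {(fst p + n * a, snd p + n * b) |n. True}"

definition tside :: "int \<Rightarrow> int \<Rightarrow> cell \<Rightarrow> nat \<Rightarrow> tedge" where
  "tside a b p k = {tv a b (corner p k), tv a b (corner p (Suc k))}"

definition tube_cells :: "int \<Rightarrow> int \<Rightarrow> tcell set" where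
  "tube_cells a b = range (tc a b)"

definition tube_edges :: "int \<Rightarrow> int \<Rightarrow> tedge set" where
  "tube_edges a b = {tside a b p k |p k. True}"

text \<open>Opposite sides of a hexagon are parallel, so the edge-direction is the side number modulo 3.\<close>

definition has_direction :: "int \<Rightarrow> int \<Rightarrow> tedge \<Rightarrow> nat \<Rightarrow> bool" where
  "has_direction a b e d \<longleftrightarrow> (\<exists>p k. e = tside a b p k \<and> d = k mod 3)"


section \<open>Cycles and nanotubes\<close>

text \<open>Cycles are given by the cyclic list of their vertices; the graph is given by its edge set.\<close>

definition cyc_edge :: "'v list \<Rightarrow> nat \<Rightarrow> 'v set" where
  "cyc_edge C i = {C ! (i mod length C), C ! (Suc i mod length C)}"

definition cyc_edges :: "'v list \<Rightarrow> 'v set set" where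
  "cyc_edges C = {cyc_edge C i |i. i < length C}"

definition is_cycle :: "'v set set \<Rightarrow> 'v list \<Rightarrow> bool" where
  "is_cycle E C \<longleftrightarrow> 3 \<le> length C \<and> distinct C \<and> cyc_edges C \<subseteq> E"

text \<open>
  A cycle encircles the axis iff going once around it, lifted to the plane, is a walk that does not
  return to its starting point (it ends at a nonzero translate by a multiple of \<open>a a1 + b a2\<close>).
\<close>

definition encircles :: "int \<Rightarrow> int \<Rightarrow> tvert list \<Rightarrow> bool" where
  "encircles a b C \<longleftrightarrow>
     (\<exists>w :: nat \<Rightarrow> hvert.
        (\<forall>i. i \<le> length C \<longrightarrow> w i \<in> C ! (i mod length C)) \<and>
        (\<forall>i. i < length C \<longrightarrow> (\<exists>p k. {w i, w (Suc i)} = side p k)) \<and>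
        w (length C) \<noteq> w 0)"

text \<open>
  \<open>region a b E P\<close> is the connected component containing the hexagon \<open>P\<close> of the cylinder cut along
  the edges in \<open>E\<close>, as the set of the hexagons in it.
\<close>

definition crossing :: "int \<Rightarrow> int \<Rightarrow> tedge set \<Rightarrow> (tcell \<times> tcell) set" where
  "crossing a b E = {(tc a b p, tc a b (nbr p k)) |p k. tside a b p k \<notin> E}"

definition region :: "int \<Rightarrow> int \<Rightarrow> tedge set \<Rightarrow> tcell \<Rightarrow> tcell set" where
  "region a b E P = {Q. (P, Q) \<in> (crossing a b E)\<^sup>*}"

definition open_ends :: "int \<Rightarrow> int \<Rightarrow> tvert list \<Rightarrow> tvert list \<Rightarrow> bool" where
  "open_ends a b C1 C2 \<longleftrightarrow>
     (\<forall>C \<in> {C1, C2}. is_cycle (tube_edges a b) C \<and> 4 \<le> length C \<and> encircles a b C) \<and>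
     set C1 \<inter> set C2 = {}"

text \<open>
  Two disjoint cycles encircling the axis cut the cylinder into two unbounded parts and the
  bounded part between them.
\<close>

definition nt_hexagons :: "int \<Rightarrow> int \<Rightarrow> tvert list \<Rightarrow> tvert list \<Rightarrow> tcell set" where
  "nt_hexagons a b C1 C2 =
     {P \<in> tube_cells a b. finite (region a b (cyc_edges C1 \<union> cyc_edges C2) P)}"

definition nt_verts :: "int \<Rightarrow> int \<Rightarrow> tvert list \<Rightarrow> tvert list \<Rightarrow> tvert set" where
  "nt_verts a b C1 C2 =
     set C1 \<union> set C2 \<union> {tv a b (corner p k) |p k. tc a b p \<in> nt_hexagons a b C1 C2}"

definition nt_edges :: "int \<Rightarrow> int \<Rightarrow> tvert list \<Rightarrow> tvert list \<Rightarrow> tedge set" where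
  "nt_edges a b C1 C2 =
     cyc_edges C1 \<union> cyc_edges C2 \<union> {tside a b p k |p k. tc a b p \<in> nt_hexagons a b C1 C2}"


section \<open>Perfect matchings, colourings and the resonance graph\<close>

definition perfect_matching :: "'v set \<Rightarrow> 'v set set \<Rightarrow> 'v set set \<Rightarrow> bool" where
  "perfect_matching V E M \<longleftrightarrow> M \<subseteq> E \<and> (\<forall>v\<in>V. \<exists>!e. e \<in> M \<and> v \<in> e)"

datatype colour = Black | White

definition proper_colouring :: "'v set set \<Rightarrow> ('v \<Rightarrow> colour) \<Rightarrow> bool" where
  "proper_colouring E col \<longleftrightarrow> (\<forall>u v. {u, v} \<in> E \<longrightarrow> col u \<noteq> col v)"

abbreviation nt_perfect_matching ::
  "int \<Rightarrow> int \<Rightarrow> tvert list \<Rightarrow> tvert list \<Rightarrow> tedge set \<Rightarrow> bool" where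
  "nt_perfect_matching a b C1 C2 \<equiv> perfect_matching (nt_verts a b C1 C2) (nt_edges a b C1 C2)"

definition R6_adj ::
  "int \<Rightarrow> int \<Rightarrow> tvert list \<Rightarrow> tvert list \<Rightarrow> (tedge set \<times> tedge set) set" where
  "R6_adj a b C1 C2 =
     {(M, M'). nt_perfect_matching a b C1 C2 M \<and> nt_perfect_matching a b C1 C2 M' \<and>
        (\<exists>p. tc a b p \<in> nt_hexagons a b C1 C2 \<and>
             (M - M') \<union> (M' - M) = {tside a b p k |k. k < 6})}"

definition same_R6_component ::
  "int \<Rightarrow> int \<Rightarrow> tvert list \<Rightarrow> tvert list \<Rightarrow> tedge set \<Rightarrow> tedge set \<Rightarrow> bool" where
  "same_R6_component a b C1 C2 M M' \<longleftrightarrow>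
     nt_perfect_matching a b C1 C2 M \<and> nt_perfect_matching a b C1 C2 M' \<and>
     (M, M') \<in> (R6_adj a b C1 C2)\<^sup>*"


section \<open>Cut segments and flow\<close>

text \<open>
  The faces of the drawing of the nanotube are the components of the cylinder cut along the
  nanotube: the single hexagons between \<open>C1\<close> and \<open>C2\<close>, and two unbounded components, which become
  the hole and the exterior face. A directed dual edge is given by \<open>(p, k)\<close>, meaning the step
  from the hexagon \<open>p\<close> across its side \<open>k\<close>; this also distinguishes parallel dual edges.
\<close>

definition nt_face :: "int \<Rightarrow> int \<Rightarrow> tvert list \<Rightarrow> tvert list \<Rightarrow> cell \<Rightarrow> tcell set" where
  "nt_face a b C1 C2 p = region a b (nt_edges a b C1 C2) (tc a b p)"

definition dual_tail :: "int \<Rightarrow> int \<Rightarrow> tvert list \<Rightarrow> tvert list \<Rightarrow> cell \<times> nat \<Rightarrow> tcell set" where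
  "dual_tail a b C1 C2 d = nt_face a b C1 C2 (fst d)"

definition dual_head :: "int \<Rightarrow> int \<Rightarrow> tvert list \<Rightarrow> tvert list \<Rightarrow> cell \<times> nat \<Rightarrow> tcell set" where
  "dual_head a b C1 C2 d = nt_face a b C1 C2 (nbr (fst d) (snd d))"

definition open_end_face ::
  "int \<Rightarrow> int \<Rightarrow> tvert list \<Rightarrow> tvert list \<Rightarrow> tvert list \<Rightarrow> tcell set \<Rightarrow> bool" where
  "open_end_face a b C1 C2 C F \<longleftrightarrow>
     infinite F \<and> (\<exists>p k. F = nt_face a b C1 C2 p \<and> tside a b p k \<in> cyc_edges C)"

definition cut_segment ::
  "int \<Rightarrow> int \<Rightarrow> tvert list \<Rightarrow> tvert list \<Rightarrow> (cell \<times> nat) list \<Rightarrow> bool" where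
  "cut_segment a b C1 C2 L \<longleftrightarrow>
     L \<noteq> [] \<and>
     (\<forall>(p, k) \<in> set L. tside a b p k \<in> nt_edges a b C1 C2) \<and>
     (\<forall>i. Suc i < length L \<longrightarrow>
        dual_head a b C1 C2 (L ! i) = dual_tail a b C1 C2 (L ! Suc i)) \<and>
     distinct (dual_tail a b C1 C2 (hd L) # map (dual_head a b C1 C2) L) \<and>
     (open_end_face a b C1 C2 C1 (dual_tail a b C1 C2 (hd L)) \<and>
        open_end_face a b C1 C2 C2 (dual_head a b C1 C2 (last L)) \<or>
      open_end_face a b C1 C2 C2 (dual_tail a b C1 C2 (hd L)) \<and>
        open_end_face a b C1 C2 C1 (dual_head a b C1 C2 (last L)))"

text \<open>
  The corners are numbered anticlockwise, so on leaving \<open>p\<close> across its side \<open>k\<close> the corner \<open>k + 1\<close>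
  is on the left and the corner \<open>k\<close> on the right. Here left and right refer to the orientation of
  the lattice plane. A plane drawing of the nanotube with the opposite orientation exchanges left
  and right everywhere, which has the same effect as exchanging the two colours.
\<close>

definition cut_pos :: "int \<Rightarrow> int \<Rightarrow> (tvert \<Rightarrow> colour) \<Rightarrow> (cell \<times> nat) list \<Rightarrow> tedge set" where
  "cut_pos a b col L = {tside a b p k |p k. (p, k) \<in> set L \<and> col (tv a b (corner p (Suc k))) = White}"

definition cut_neg :: "int \<Rightarrow> int \<Rightarrow> (tvert \<Rightarrow> colour) \<Rightarrow> (cell \<times> nat) list \<Rightarrow> tedge set" where
  "cut_neg a b col L = {tside a b p k |p k. (p, k) \<in> set L \<and> col (tv a b (corner p k)) = White}"

definition flow ::
  "int \<Rightarrow> int \<Rightarrow> (tvert \<Rightarrow> colour) \<Rightarrow> (cell \<times> nat) list \<Rightarrow> tedge set \<Rightarrow> int" where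
  "flow a b col L M = int (card (cut_pos a b col L \<inter> M)) - int (card (cut_neg a b col L \<inter> M))"


section \<open>Ladders\<close>

definition zigzag_cycle :: "int \<Rightarrow> int \<Rightarrow> tedge set \<Rightarrow> tvert list \<Rightarrow> bool" where
  "zigzag_cycle a b E Z \<longleftrightarrow>
     is_cycle E Z \<and> even (length Z) \<and>
     (\<exists>d d'. d \<noteq> d' \<and>
        (\<forall>i<length Z. has_direction a b (cyc_edge Z i) (if even i then d else d')))"

definition alternating :: "'v set set \<Rightarrow> 'v list \<Rightarrow> bool" where
  "alternating M Z \<longleftrightarrow> (\<forall>i<length Z. cyc_edge Z i \<in> M \<longleftrightarrow> cyc_edge Z (Suc i) \<notin> M)"

definition same_ladders ::
  "int \<Rightarrow> int \<Rightarrow> tedge set \<Rightarrow> tedge set \<Rightarrow> tedge set \<Rightarrow> bool" where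
  "same_ladders a b E M1 M2 \<longleftrightarrow>
     (\<forall>Z. zigzag_cycle a b E Z \<longrightarrow>
        (alternating M1 Z \<longleftrightarrow> alternating M2 Z) \<and>
        (alternating M1 Z \<longrightarrow> M1 \<inter> cyc_edges Z = M2 \<inter> cyc_edges Z))"

end

theory Submission
  imports Defs
begin

text \<open>
  Two perfect matchings \<open>M\<close> and \<open>M'\<close> are compared by a height function. Give the dual step across an
  edge \<open>e\<close> the value \<open>[e \<in> M'] - [e \<in> M]\<close>, with the sign that the flow gives to \<open>e\<close>. Both matchings
  cover every vertex of the nanotube exactly once, so these values add up to zero around every
  vertex. Hence they are the differences of an integer function \<open>h\<close> on the hexagons of the cylinder
  (\<open>potential_exists\<close>). Outside the nanotube \<open>h\<close> is constant on each of the two unbounded faces, and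
  along a cut segment its differences add up to the difference of the flows (\<open>flow_potential\<close>).

  A flip changes \<open>h\<close> only at the flipped hexagon, so it preserves the flow. It also preserves ladders,
  because an alternating hexagon has no side on a ladder (\<open>ladder_avoids_alternating_hexagon\<close>).

  Conversely, let the flows and the ladders agree. Then \<open>h\<close> can be normalised to vanish outside the
  nanotube. If \<open>h\<close> is not zero, say with positive maximum, it is enough to find a hexagon in the set
  \<open>S\<close> where \<open>h\<close> is maximal, at which a flip of \<open>M\<close> or of \<open>M'\<close> lowers \<open>h\<close>; induction does the rest
  (\<open>same_ladders_connected\<close>). Let the sides 0, 2, 4 be those at which being unmatched in \<open>M\<close> means
  that \<open>h\<close> does not decrease across (or else \<open>M'\<close> takes the part of \<open>M\<close>). If no hexagon of \<open>S\<close> can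
  be flipped in \<open>M\<close>, then every hexagon of \<open>S\<close> can be left across such an unmatched side
  without leaving \<open>S\<close>, and this can be repeated for ever. The key observation is that two
  consecutive steps of this kind in different directions can be exchanged (\<open>pass_commute\<close>).
  So a long walk can be sorted into straight pieces, and one of them is so long that, \<open>S\<close> being finite, it closes up to a straight row around the cylinder
  (\<open>straight_row\<close>). The zigzag cycle next to this row is then a ladder of \<open>M\<close>. It is also a ladder
  of \<open>M'\<close> with the same edges, so \<open>h\<close> has the same value beyond it, and the next row of hexagons has
  all the properties of the first one (\<open>next_row\<close>). Thus \<open>S\<close> contains infinitely many rows, which is
  impossible (\<open>flippable_hexagon\<close>).
\<close>

section \<open>Hexagons and translations\<close>

definition nbr_vec :: "nat \<Rightarrow> cell" where
  "nbr_vec k = nbr (0, 0) k"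

definition ray :: "cell \<Rightarrow> nat \<Rightarrow> int \<Rightarrow> cell" where
  "ray p k t = (fst p + t * fst (nbr_vec k), snd p + t * snd (nbr_vec k))"

text \<open>
  Side and corner numbers matter only modulo 6. Writing \<open>k\<close> as \<open>6 m + r\<close>, rather than as
  \<open>k mod 6 = r\<close>, lets the simplifier compute the residues of \<open>k + 1\<close>, \<open>k + 2\<close>, \<open>\<dots>\<close> by itself.
\<close>
lemma residue_6:
  obtains m where "k = 6 * m" | m where "k = 6 * m + 1" | m where "k = 6 * m + 2"
  | m where "k = 6 * m + 3" | m where "k = 6 * m + 4" | m where "k = 6 * m + (5::nat)"
proof -
  have k: "k = 6 * (k div 6) + k mod 6" by simp
  have "k mod 6 < 6" by simp
  then consider "k mod 6 = 0" | "k mod 6 = 1" | "k mod 6 = 2" | "k mod 6 = 3" | "k mod 6 = 4"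
    | "k mod 6 = 5" by linarith
  then show ?thesis
    using k that by cases (metis add_0_right)+
qed

lemma residue_6_mod [simp]:
  fixes m n :: nat
  shows "Suc (6 * m) mod 6 = 1" "Suc (Suc (6 * m)) mod 6 = 2"
    "Suc (Suc (Suc (6 * m))) mod 6 = 3" "Suc (Suc (Suc (Suc (6 * m)))) mod 6 = 4"
    "Suc (6 * m + 3) mod 6 = 4" "Suc (6 * m + 4) mod 6 = 5" "Suc (6 * m + 5) mod 6 = 0"
    "(6 * m) mod 3 = 0" "Suc (6 * m) mod 3 = 1" "Suc (Suc (6 * m)) mod 3 = 2"
    "(6 * m + n) mod 3 = n mod 3" "(n + 6 * m) mod 3 = n mod 3"
proof -
  have *: "6 * m = 3 * (2 * m)" by simp
  show "(6 * m + n) mod 3 = n mod 3" "(n + 6 * m) mod 3 = n mod 3"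
    unfolding * by (rule mod_mult_self4, rule mod_mult_self2)
qed presburger+

lemma nbr_eq: "nbr p k = (fst p + fst (nbr_vec k), snd p + snd (nbr_vec k))"
  by (cases p, cases rule: residue_6[of k]) (simp_all add: nbr_vec_def)

lemma nbr_ray: "nbr p k = ray p k 1"
  by (simp add: nbr_eq ray_def)

lemma ray_0 [simp]: "ray p k 0 = p"
  by (simp add: ray_def)

lemma ray_ray: "ray (ray p k s) k t = ray p k (s + t)"
  by (simp add: ray_def algebra_simps)

lemma ray_commute: "ray (ray p k s) l t = ray (ray p l t) k s"
  by (simp add: ray_def algebra_simps)

lemma nbr_back: "nbr (nbr p k) (k + 3) = p"
  by (cases p, cases rule: residue_6[of k]) simp_all

text \<open>
  The hexagons across two consecutive sides of \<open>p\<close> meet \<open>p\<close> at a common corner; the step from the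
  first of them to the second keeps that corner on its left.
\<close>
lemma nbr_turn: "nbr (nbr p k) (k + 2) = nbr p (k + 1)"
  by (cases p, cases rule: residue_6[of k]) simp_all

lemma nbr_cong: "k mod 6 = l mod 6 \<Longrightarrow> nbr p k = nbr p l"
  by (cases p) simp

lemma corner_cong: "k mod 6 = l mod 6 \<Longrightarrow> corner p k = corner p l"
  by (cases p) simp

lemma corner_nbr: "corner (nbr p k) (k + 3) = corner p (k + 1)"
  and corner_nbr': "corner (nbr p k) (k + 4) = corner p k"
  by (cases p, cases rule: residue_6[of k]; simp)+

section \<open>Edges of the cylinder in normal form\<close>

definition dn_vec :: "nat \<Rightarrow> cell" where
  "dn_vec d = [(-1, 0), (0, 0), (0, -1)] ! (d mod 3)"

definition up_end :: "cell \<Rightarrow> nat \<Rightarrow> cell" where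
  "up_end p k = (fst p + [0, -1, -1, 0, 0, 0] ! (k mod 6), snd p + [0, 0, 0, -1, -1, 0] ! (k mod 6))"

text \<open>
  An edge of the hexagonal lattice has exactly one end of the form \<open>Up\<close>. Listing edges by that end
  and by their direction is a unique description, while a side \<open>(p, k)\<close> has two.
\<close>
definition up_edge :: "int \<Rightarrow> int \<Rightarrow> cell \<Rightarrow> nat \<Rightarrow> tedge" where
  "up_edge a b x d =
    {tv a b (Up (fst x) (snd x)), tv a b (Dn (fst x + fst (dn_vec d)) (snd x + snd (dn_vec d)))}"

lemma tside_up_edge: "tside a b p k = up_edge a b (up_end p k) k"
  by (cases p, cases rule: residue_6[of k])
    (simp_all add: tside_def up_edge_def up_end_def dn_vec_def insert_commute)

lemma up_end_nbr: "up_end (nbr p k) (k + 3) = up_end p k"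
  by (cases p, cases rule: residue_6[of k]) (simp_all add: up_end_def)

lemma tc_eq_iff: "tc a b p = tc a b q \<longleftrightarrow> (\<exists>n. fst q = fst p + n * a \<and> snd q = snd p + n * b)"
proof
  assume "tc a b p = tc a b q"
  moreover have "q \<in> tc a b q" unfolding tc_def by (auto intro!: exI[of _ 0] simp: prod_eq_iff)
  ultimately have "q \<in> tc a b p" by simp
  then show "\<exists>n. fst q = fst p + n * a \<and> snd q = snd p + n * b" unfolding tc_def by auto
next
  assume "\<exists>n. fst q = fst p + n * a \<and> snd q = snd p + n * b"
  then obtain n where n: "fst q = fst p + n * a" "snd q = snd p + n * b" by blast
  show "tc a b p = tc a b q"
  proof (rule set_eqI)
    fix x
    have "x \<in> tc a b p \<longleftrightarrow> (\<exists>m. x = (fst p + m * a, snd p + m * b))" by (auto simp: tc_def)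
    also have "\<dots> \<longleftrightarrow> (\<exists>m. x = (fst q + m * a, snd q + m * b))"
    proof
      assume "\<exists>m. x = (fst p + m * a, snd p + m * b)"
      then obtain m where "x = (fst p + m * a, snd p + m * b)" by blast
      then show "\<exists>m. x = (fst q + m * a, snd q + m * b)"
        by (intro exI[of _ "m - n"]) (simp add: n algebra_simps)
    next
      assume "\<exists>m. x = (fst q + m * a, snd q + m * b)"
      then obtain m where "x = (fst q + m * a, snd q + m * b)" by blast
      then show "\<exists>m. x = (fst p + m * a, snd p + m * b)"
        by (intro exI[of _ "m + n"]) (simp add: n algebra_simps)
    qed
    also have "\<dots> \<longleftrightarrow> x \<in> tc a b q" by (auto simp: tc_def)
    finally show "x \<in> tc a b p \<longleftrightarrow> x \<in> tc a b q" .
  qed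
qed

lemma tv_Up: "tv a b (Up i j) = (\<lambda>x. Up (fst x) (snd x)) ` tc a b (i, j)"
  and tv_Dn: "tv a b (Dn i j) = (\<lambda>x. Dn (fst x) (snd x)) ` tc a b (i, j)"
  by (auto simp: tv_def tc_def image_def)

lemma tc_nonempty: "tc a b p \<noteq> {}"
  by (auto simp: tc_def)

lemma tv_eq_iff [simp]:
  "tv a b (Up i j) = tv a b (Up i' j') \<longleftrightarrow> tc a b (i, j) = tc a b (i', j')"
  "tv a b (Dn i j) = tv a b (Dn i' j') \<longleftrightarrow> tc a b (i, j) = tc a b (i', j')"
  "tv a b (Up i j) \<noteq> tv a b (Dn i' j')"
  "tv a b (Dn i j) \<noteq> tv a b (Up i' j')"
proof -
  have "inj (\<lambda>x::cell. Up (fst x) (snd x))" "inj (\<lambda>x::cell. Dn (fst x) (snd x))"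
    by (auto simp: inj_def prod_eq_iff)
  then show "tv a b (Up i j) = tv a b (Up i' j') \<longleftrightarrow> tc a b (i, j) = tc a b (i', j')"
    "tv a b (Dn i j) = tv a b (Dn i' j') \<longleftrightarrow> tc a b (i, j) = tc a b (i', j')"
    by (simp_all add: tv_Up tv_Dn inj_image_eq_iff)
  have "(\<lambda>x::cell. Up (fst x) (snd x)) ` A \<noteq> (\<lambda>x::cell. Dn (fst x) (snd x)) ` B" if "A \<noteq> {}" for A B
    using that by blast
  then show "tv a b (Up i j) \<noteq> tv a b (Dn i' j')" "tv a b (Dn i j) \<noteq> tv a b (Up i' j')"
    unfolding tv_Up tv_Dn using tc_nonempty by metis+
qed

lemma tc_shift_iff:
  "tc a b (fst p + x, snd p + y) = tc a b (fst q + x, snd q + y) \<longleftrightarrow> tc a b p = tc a b q"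
  by (simp add: tc_eq_iff algebra_simps)

lemma tc_ray_iff: "tc a b (ray p k t) = tc a b (ray q k t) \<longleftrightarrow> tc a b p = tc a b q"
  unfolding ray_def by (rule tc_shift_iff)

lemma tc_nbr_iff: "tc a b (nbr p k) = tc a b (nbr q k) \<longleftrightarrow> tc a b p = tc a b q"
  unfolding nbr_ray by (rule tc_ray_iff)

lemma tv_corner_shift:
  assumes "tc a b p = tc a b q"
  shows "tv a b (corner p k) = tv a b (corner q k)"
proof -
  have *: "tc a b (fst p + x, snd p + y) = tc a b (fst q + x, snd q + y)" for x y
    using assms by (simp only: tc_shift_iff)
  obtain i j i' j' where [simp]: "p = (i, j)" "q = (i', j')" by fastforce
  show ?thesis
    apply (cases rule: residue_6[of k])
    subgoal using *[of 0 0] by simp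
    subgoal using *[of "-1" 0] by simp
    subgoal using *[of "-1" 0] by simp
    subgoal using *[of "-1" "-1"] by simp
    subgoal using *[of 0 "-1"] by simp
    subgoal using *[of 0 "-1"] by simp
    done
qed

lemma tside_shift: "tc a b p = tc a b q \<Longrightarrow> tside a b p k = tside a b q k"
  unfolding tside_def using tv_corner_shift[of a b p q] by metis

lemma tside_cong: "k mod 6 = l mod 6 \<Longrightarrow> tside a b p k = tside a b p l"
proof -
  assume "k mod 6 = l mod 6"
  moreover from this have "Suc k mod 6 = Suc l mod 6" by (metis mod_Suc)
  ultimately have "corner p k = corner p l" "corner p (Suc k) = corner p (Suc l)"
    by (blast intro: corner_cong)+
  then show ?thesis unfolding tside_def by metis
qed

lemma tside_nbr: "tside a b (nbr p k) (k + 3) = tside a b p k"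
  using corner_nbr[of p k] corner_nbr'[of p k] unfolding tside_def
  by (simp del: corner.simps nbr.simps add: insert_commute add.commute)

lemma tube_edge_cases:
  assumes "e \<in> tube_edges a b"
  obtains x d where "e = up_edge a b x d" "d < 3"
proof -
  obtain p k where "e = tside a b p k" using assms by (auto simp: tube_edges_def)
  then have "e = up_edge a b (up_end p k) (k mod 3)" by (simp add: tside_up_edge up_edge_def dn_vec_def)
  then show ?thesis using that by simp
qed

lemma Up_in_up_edge: "tv a b (Up i j) \<in> up_edge a b x d \<longleftrightarrow> tc a b x = tc a b (i, j)"
  by (auto simp: up_edge_def)

lemma Dn_in_up_edge:
  "tv a b (Dn i j) \<in> up_edge a b x d \<longleftrightarrow> tc a b x = tc a b (i - fst (dn_vec d), j - snd (dn_vec d))"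
  using tc_shift_iff[of a b x "fst (dn_vec d)" "snd (dn_vec d)" "(i - fst (dn_vec d), j - snd (dn_vec d))"]
  by (auto simp: up_edge_def)

lemma up_edge_shift:
  assumes "tc a b x = tc a b y"
  shows "up_edge a b x d = up_edge a b y d"
proof -
  have "tv a b (Up (fst x) (snd x)) = tv a b (Up (fst y) (snd y))"
    "tv a b (Dn (fst x + fst (dn_vec d)) (snd x + snd (dn_vec d))) =
      tv a b (Dn (fst y + fst (dn_vec d)) (snd y + snd (dn_vec d)))"
    using assms by (simp_all add: tc_shift_iff)
  then show ?thesis unfolding up_edge_def by metis
qed

lemma side_in_tube [simp]: "tside a b p k \<in> tube_edges a b"
  unfolding tube_edges_def by blast

text \<open>
  The three hexagons at the corner \<open>k + 1\<close> of \<open>p\<close> are \<open>p\<close> and the hexagons across its sides \<open>k\<close> and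
  \<open>k + 1\<close>. The third edge, which runs away from \<open>p\<close>, separates the latter two.
\<close>
lemma edges_at_corner:
  assumes "e \<in> tube_edges a b"
  shows "tv a b (corner p (k + 1)) \<in> e \<longleftrightarrow>
    e \<in> {tside a b p k, tside a b (nbr p k) (k + 2), tside a b p (k + 1)}"
    (is "?v \<in> e \<longleftrightarrow> e \<in> {?e1, ?e2, ?e3}")
proof
  assume "e \<in> {?e1, ?e2, ?e3}"
  moreover have "?v \<in> ?e1" by (simp add: tside_def del: corner.simps)
  moreover have "?v \<in> ?e2"
    using corner_nbr[of p k] by (simp add: tside_def numeral_eq_Suc del: corner.simps nbr.simps)
  moreover have "?v \<in> ?e3"
    by (simp add: tside_def del: corner.simps)
  ultimately show "?v \<in> e" by blast
next
  assume v: "?v \<in> e"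
  obtain x d where e: "e = up_edge a b x d" and d: "d < 3" using assms by (rule tube_edge_cases)
  have d: "d = 0 \<or> d = 1 \<or> d = 2" using d by auto
  obtain i j where p: "p = (i, j)" by fastforce
  have up: "e = up_edge a b (i, j) d" if "tv a b (Up i j) \<in> e" for i j
    using that up_edge_shift unfolding e Up_in_up_edge by blast
  have dn: "e = up_edge a b (i - fst (dn_vec d), j - snd (dn_vec d)) d" if "tv a b (Dn i j) \<in> e" for i j
    using that up_edge_shift unfolding e Dn_in_up_edge by blast
  show "e \<in> {?e1, ?e2, ?e3}"
  proof (cases rule: residue_6[of k])
    case (1 m)
    have "e = up_edge a b (i - 1 - fst (dn_vec d), j - snd (dn_vec d)) d"
      by (rule dn) (use v in \<open>simp add: p 1\<close>)
    then show ?thesis using d by (elim disjE) (simp_all add: p 1 tside_up_edge up_edge_def up_end_def dn_vec_def)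
  next
    case (2 m)
    have "e = up_edge a b (i - 1, j) d" by (rule up) (use v in \<open>simp add: p 2\<close>)
    then show ?thesis using d by (elim disjE) (simp_all add: p 2 tside_up_edge up_edge_def up_end_def dn_vec_def)
  next
    case (3 m)
    have "e = up_edge a b (i - 1 - fst (dn_vec d), j - 1 - snd (dn_vec d)) d"
      by (rule dn) (use v in \<open>simp add: p 3\<close>)
    then show ?thesis using d by (elim disjE) (simp_all add: p 3 tside_up_edge up_edge_def up_end_def dn_vec_def)
  next
    case (4 m)
    have "e = up_edge a b (i, j - 1) d" by (rule up) (use v in \<open>simp add: p 4\<close>)
    then show ?thesis using d by (elim disjE) (simp_all add: p 4 tside_up_edge up_edge_def up_end_def dn_vec_def)
  next
    case (5 m)
    have "e = up_edge a b (i - fst (dn_vec d), j - 1 - snd (dn_vec d)) d"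
      by (rule dn) (use v in \<open>simp add: p 5\<close>)
    then show ?thesis using d by (elim disjE) (simp_all add: p 5 tside_up_edge up_edge_def up_end_def dn_vec_def)
  next
    case (6 m)
    have "e = up_edge a b (i, j) d" by (rule up) (use v in \<open>simp add: p 6\<close>)
    then show ?thesis using d by (elim disjE) (simp_all add: p 6 tside_up_edge up_edge_def up_end_def dn_vec_def)
  qed
qed

lemma nbr_vec_small:
  "\<bar>fst (nbr_vec k)\<bar> \<le> 1" "\<bar>snd (nbr_vec k)\<bar> \<le> 1" "\<bar>fst (nbr_vec k) + snd (nbr_vec k)\<bar> \<le> 1"
  "\<not> (fst (nbr_vec k) = 0 \<and> snd (nbr_vec k) = 0)"
  by (cases rule: residue_6[of k]; simp add: nbr_vec_def)+

text \<open>
  Translations by a vector joining neighbouring hexagons are excluded: they would create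
  parallel edges.
\<close>
locale tube =
  fixes a b :: int
  assumes nonzero: "(a, b) \<noteq> (0, 0)" and nonshort: "(a, b) \<noteq> nbr_vec k"
begin

text \<open>
  Neighbouring hexagons, and the vertices of one kind around a hexagon, differ by one of the six short
  vectors. These are primitive, so no multiple of \<open>(a, b)\<close> is one of them.
\<close>
lemma tc_eq_near:
  assumes "tc a b (i, j) = tc a b (i + x, j + y)" "\<bar>x\<bar> \<le> 1" "\<bar>y\<bar> \<le> 1" "\<bar>x + y\<bar> \<le> 1"
  shows "x = 0 \<and> y = 0"
proof (rule ccontr)
  assume nz: "\<not> (x = 0 \<and> y = 0)"
  obtain n where n: "x = n * a" "y = n * b" using assms(1) by (auto simp: tc_eq_iff)
  have "n dvd 1"
  proof (cases "x = 0")
    case True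
    then have "y = 1 \<or> y = -1" using nz assms(3) by auto
    then show ?thesis using n(2) by (metis dvd_triv_left dvd_minus_iff)
  next
    case False
    then have "x = 1 \<or> x = -1" using nz assms(2) by auto
    then show ?thesis using n(1) by (metis dvd_triv_left dvd_minus_iff)
  qed
  then have "n = 1 \<or> n = -1" by auto
  then have "(a, b) = (x, y) \<or> (a, b) = (- x, - y)" using n by auto
  moreover obtain k where "(x, y) = nbr_vec k" "(- x, - y) = nbr_vec (k + 3)"
  proof -
    have "x = 0 \<or> x = 1 \<or> x = -1" "y = 0 \<or> y = 1 \<or> y = -1" using assms by linarith+
    then consider "x = 0" "y = 1" | "x = -1" "y = 1" | "x = -1" "y = 0" | "x = 0" "y = -1"
      | "x = 1" "y = -1" | "x = 1" "y = 0"
      using nz assms(4) by fastforce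
    then show thesis
      using that[of 0] that[of 1] that[of 2] that[of 3] that[of 4] that[of 5]
      by cases (simp_all add: nbr_vec_def)
  qed
  ultimately show False using nonshort by metis
qed

lemma nbr_neq: "tc a b (nbr p k) \<noteq> tc a b p"
proof
  assume "tc a b (nbr p k) = tc a b p"
  then have "tc a b (fst p, snd p) = tc a b (fst p + fst (nbr_vec k), snd p + snd (nbr_vec k))"
    unfolding nbr_eq by simp
  then show False using tc_eq_near nbr_vec_small[of k] by blast
qed

lemma up_edge_eq_iff: "up_edge a b x d = up_edge a b y d' \<longleftrightarrow> tc a b x = tc a b y \<and> d mod 3 = d' mod 3"
proof
  assume eq: "up_edge a b x d = up_edge a b y d'"
  let ?p = "(fst x + fst (dn_vec d), snd x + snd (dn_vec d))"
  have xy: "tc a b x = tc a b y"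
    using eq Up_in_up_edge[of a b "fst x" "snd x" x d] Up_in_up_edge[of a b "fst x" "snd x" y d'] by simp
  have "tv a b (Dn (fst ?p) (snd ?p)) \<in> up_edge a b x d" by (simp add: up_edge_def)
  then have "tc a b y = tc a b (fst x + fst (dn_vec d) - fst (dn_vec d'), snd x + snd (dn_vec d) - snd (dn_vec d'))"
    unfolding eq Dn_in_up_edge by simp
  then have "fst (dn_vec d) - fst (dn_vec d') = 0 \<and> snd (dn_vec d) - snd (dn_vec d') = 0"
  proof (intro tc_eq_near[of "fst x" "snd x"], goal_cases)
    case 1 then show ?case using xy by (simp add: algebra_simps)
  next
    case 2
    have "d mod 3 < 3" "d' mod 3 < 3" by simp_all
    then have "d mod 3 = 0 \<or> d mod 3 = 1 \<or> d mod 3 = 2" "d' mod 3 = 0 \<or> d' mod 3 = 1 \<or> d' mod 3 = 2" by arith+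
    then show ?case by (auto simp: dn_vec_def)
  next
    case 3
    have "d mod 3 < 3" "d' mod 3 < 3" by simp_all
    then have "d mod 3 = 0 \<or> d mod 3 = 1 \<or> d mod 3 = 2" "d' mod 3 = 0 \<or> d' mod 3 = 1 \<or> d' mod 3 = 2" by arith+
    then show ?case by (auto simp: dn_vec_def)
  next
    case 4
    have "d mod 3 < 3" "d' mod 3 < 3" by simp_all
    then have "d mod 3 = 0 \<or> d mod 3 = 1 \<or> d mod 3 = 2" "d' mod 3 = 0 \<or> d' mod 3 = 1 \<or> d' mod 3 = 2" by arith+
    then show ?case by (auto simp: dn_vec_def)
  qed
  moreover have "d mod 3 < 3" "d' mod 3 < 3" by simp_all
  then have "d mod 3 = 0 \<or> d mod 3 = 1 \<or> d mod 3 = 2" "d' mod 3 = 0 \<or> d' mod 3 = 1 \<or> d' mod 3 = 2" by arith+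
  ultimately show "tc a b x = tc a b y \<and> d mod 3 = d' mod 3"
    using xy by (auto simp: dn_vec_def)
next
  assume "tc a b x = tc a b y \<and> d mod 3 = d' mod 3"
  then show "up_edge a b x d = up_edge a b y d'"
    using up_edge_shift[of a b x y d] by (simp add: up_edge_def dn_vec_def)
qed

text \<open>
  The cylinder has no parallel edges, so an edge determines the pair of hexagons that it separates.
\<close>
lemma tside_eq_iff:
  "tside a b p k = tside a b q l \<longleftrightarrow>
    tc a b p = tc a b q \<and> k mod 6 = l mod 6 \<or> tc a b (nbr p k) = tc a b q \<and> (k + 3) mod 6 = l mod 6"
proof
  assume eq: "tside a b p k = tside a b q l"
  then have m3: "k mod 3 = l mod 3" and u: "tc a b (up_end p k) = tc a b (up_end q l)"
    by (simp_all add: tside_up_edge up_edge_eq_iff)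
  have "k mod 6 = l mod 6 \<or> (k + 3) mod 6 = l mod 6"
    using m3 by (cases rule: residue_6[of k]; cases rule: residue_6[of l]) simp_all
  then consider "k mod 6 = l mod 6" | "(k + 3) mod 6 = l mod 6" by blast
  then show "tc a b p = tc a b q \<and> k mod 6 = l mod 6 \<or>
    tc a b (nbr p k) = tc a b q \<and> (k + 3) mod 6 = l mod 6"
  proof cases
    case 1
    then show ?thesis using u by (simp add: up_end_def tc_shift_iff)
  next
    case 2
    then have "up_end q l = up_end q (k + 3)" by (simp add: up_end_def)
    then have "tc a b (up_end (nbr p k) (k + 3)) = tc a b (up_end q (k + 3))"
      using u by (simp only: up_end_nbr)
    then show ?thesis using 2 by (simp add: up_end_def tc_shift_iff)
  qed
next
  assume "tc a b p = tc a b q \<and> k mod 6 = l mod 6 \<or>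
    tc a b (nbr p k) = tc a b q \<and> (k + 3) mod 6 = l mod 6"
  then show "tside a b p k = tside a b q l"
    by (metis tside_cong tside_shift tside_nbr)
qed

end

section \<open>Short translations\<close>

lemma cyc_edge_mod: "cyc_edge Z (i mod length Z) = cyc_edge Z i"
  by (simp add: cyc_edge_def mod_Suc_eq)

lemma cyc_edge_in: "Z \<noteq> [] \<Longrightarrow> cyc_edge Z i \<in> cyc_edges Z"
  unfolding cyc_edges_def mem_Collect_eq
  by (rule exI[of _ "i mod length Z"]) (simp add: cyc_edge_mod)

lemma is_cycle_nonempty: "is_cycle E Z \<Longrightarrow> Z \<noteq> []"
  by (auto simp: is_cycle_def)

text \<open>
  If the translation is one of the six short vectors, the quotient is an infinite path with some of
  its edges doubled. The label below is the position on that path: a linear functional that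
  vanishes on the translation, doubled to make room for the two kinds of vertices.
\<close>
lemma short_no_cycle:
  assumes ab: "(a, b) = nbr_vec k" and cyc: "is_cycle (tube_edges a b) Z"
  shows False
proof -
  define f :: "int \<Rightarrow> int \<Rightarrow> int" where
    "f i j = (if k mod 3 = 0 then i else if k mod 3 = 1 then i + j else j)" for i j
  define lab where "lab v = (case v of Up i j \<Rightarrow> 2 * f i j | Dn i j \<Rightarrow> 2 * f i j + 1)" for v
  have f_iff: "tc a b (i, j) = tc a b (i', j') \<longleftrightarrow> f i j = f i' j'" for i j i' j'
  proof
    assume "tc a b (i, j) = tc a b (i', j')"
    then show "f i j = f i' j'"
      using ab by (cases rule: residue_6[of k]) (auto simp: tc_eq_iff f_def nbr_vec_def)
  next
    assume f: "f i j = f i' j'"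
    show "tc a b (i, j) = tc a b (i', j')"
      using f ab unfolding tc_eq_iff
      \<comment> \<open>\<open>a\<close> and \<open>b\<close> are 0, 1 or -1, so multiplying by them is dividing by them\<close>
      by (intro exI[of _ "a * (i' - i) + b * (if a = 0 then j' - j else 0)"], cases rule: residue_6[of k])
        (auto simp: f_def nbr_vec_def)
  qed
  have lab_iff: "tv a b v = tv a b w \<longleftrightarrow> lab v = lab w" for v w
  proof (cases v; cases w)
    fix i j i' j' assume "v = Up i j" "w = Dn i' j'"
    moreover have "2 * f i j \<noteq> 2 * f i' j' + 1" by presburger
    ultimately show ?thesis by (simp add: lab_def)
  next
    fix i j i' j' assume "v = Dn i j" "w = Up i' j'"
    moreover have "2 * f i j + 1 \<noteq> 2 * f i' j'" by presburger
    ultimately show ?thesis by (simp add: lab_def)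
  qed (simp_all add: f_iff lab_def)
  have adjacent: "\<bar>lab v - lab w\<bar> = 1" if "{tv a b v, tv a b w} \<in> tube_edges a b" for v w
  proof -
    obtain x d where e: "{tv a b v, tv a b w} = up_edge a b x d" and d: "d < 3"
      using \<open>{tv a b v, tv a b w} \<in> tube_edges a b\<close> by (rule tube_edge_cases)
    have d: "d = 0 \<or> d = 1 \<or> d = 2" using d by auto
    let ?u = "Up (fst x) (snd x)" and ?w = "Dn (fst x + fst (dn_vec d)) (snd x + snd (dn_vec d))"
    have "k mod 3 = 0 \<or> k mod 3 = 1 \<or> k mod 3 = 2" by presburger
    then have "\<bar>lab ?u - lab ?w\<bar> = 1"
      using d by (elim disjE) (simp_all add: lab_def f_def dn_vec_def)
    moreover have "tv a b v = tv a b ?u \<and> tv a b w = tv a b ?w \<or> tv a b v = tv a b ?w \<and> tv a b w = tv a b ?u"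
      using e unfolding up_edge_def doubleton_eq_iff .
    ultimately show ?thesis unfolding lab_iff by (metis abs_minus_commute)
  qed
  let ?n = "length Z"
  have n: "3 \<le> ?n" and dist: "distinct Z" and sub: "cyc_edges Z \<subseteq> tube_edges a b"
    using cyc by (auto simp: is_cycle_def)
  have edge: "{Z ! (i mod ?n), Z ! (Suc i mod ?n)} \<in> tube_edges a b" for i
    using sub cyc_edge_in[OF is_cycle_nonempty[OF cyc]] by (auto simp: cyc_edge_def)
  have "\<exists>v. Z ! i = tv a b v" if "i < ?n" for i
  proof -
    have "{Z ! i, Z ! (Suc i mod ?n)} \<in> tube_edges a b" using edge[of i] that by simp
    then show ?thesis by (rule tube_edge_cases) (auto simp: up_edge_def doubleton_eq_iff)
  qed
  then obtain g where g: "\<And>i. i < ?n \<Longrightarrow> Z ! i = tv a b (g i)" by metis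
  define l where "l i = lab (g i)" for i
  have step: "\<bar>l (i mod ?n) - l (Suc i mod ?n)\<bar> = 1" for i
  proof -
    have "0 < ?n" using n by linarith
    then have "i mod ?n < ?n" "Suc i mod ?n < ?n" by simp_all
    then show ?thesis using edge[of i] adjacent unfolding l_def by (simp only: g)
  qed
  have inj: "i = j" if "l i = l j" "i < ?n" "j < ?n" for i j
  proof -
    have "Z ! i = Z ! j" using that g by (simp add: l_def flip: lab_iff)
    then show ?thesis using that dist by (simp add: nth_eq_iff_index_eq)
  qed
  \<comment> \<open>a vertex with the largest label has two neighbours on the cycle with equal labels\<close>
  obtain m where m: "m < ?n" "\<And>i. i < ?n \<Longrightarrow> l i \<le> l m"
  proof -
    have "0 \<in> {..<?n}" using is_cycle_nonempty[OF cyc] by simp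
    then have "finite (l ` {..<?n})" "l ` {..<?n} \<noteq> {}" by blast+
    then have "Max (l ` {..<?n}) \<in> l ` {..<?n}" and max: "\<And>i. i < ?n \<Longrightarrow> l i \<le> Max (l ` {..<?n})"
      using Max_in by auto
    then obtain m where "m < ?n" "l m = Max (l ` {..<?n})" by auto
    then show thesis using that[of m] max by simp
  qed
  have "Suc (m + ?n - 1) = m + ?n" using n by linarith
  then have *: "Suc (m + ?n - 1) mod ?n = m" using m(1) by simp
  have pos: "0 < ?n" using n by linarith
  have "l (Suc m mod ?n) = l m - 1"
    using step[of m] m(1) m(2)[OF mod_less_divisor[OF pos, of "Suc m"]] by simp
  moreover have "l ((m + ?n - 1) mod ?n) = l m - 1"
    using step[of "m + ?n - 1"] m(2)[OF mod_less_divisor[OF pos, of "m + ?n - 1"]] unfolding * by linarith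
  ultimately have "Suc m mod ?n = (m + ?n - 1) mod ?n" using pos by (intro inj) simp_all
  then have "Suc (Suc m) mod ?n = m" using * by (metis mod_Suc_eq)
  moreover have "Suc (Suc m) mod ?n = (if Suc (Suc m) < ?n then Suc (Suc m) else Suc (Suc m) - ?n)"
    using m(1) n by (simp add: mod_if)
  ultimately show False using m(1) n by (simp split: if_splits)
qed

section \<open>Perfect matchings\<close>

locale nanotube = tube +
  fixes C1 C2 :: "tvert list"
  assumes ends: "open_ends a b C1 C2"
begin

abbreviation "hexes \<equiv> nt_hexagons a b C1 C2"
abbreviation "verts \<equiv> nt_verts a b C1 C2"
abbreviation "edges \<equiv> nt_edges a b C1 C2"
abbreviation "pmatching \<equiv> nt_perfect_matching a b C1 C2"

lemma cycles: "is_cycle (tube_edges a b) C1" "is_cycle (tube_edges a b) C2"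
  using ends by (auto simp: open_ends_def)

lemma edges_tube: "edges \<subseteq> tube_edges a b"
  using cycles unfolding nt_edges_def is_cycle_def tube_edges_def by blast

lemma cyc_edges_verts:
  assumes "Z \<noteq> []" "e \<in> cyc_edges Z"
  shows "e \<subseteq> set Z"
  using assms by (auto simp: cyc_edges_def cyc_edge_def)

lemma edges_verts: "e \<in> edges \<Longrightarrow> e \<subseteq> verts"
proof -
  assume "e \<in> edges"
  then consider "e \<in> cyc_edges C1" | "e \<in> cyc_edges C2"
    | p k where "e = tside a b p k" "tc a b p \<in> hexes"
    unfolding nt_edges_def by blast
  then show "e \<subseteq> verts"
  proof cases
    case 3
    then show ?thesis unfolding tside_def nt_verts_def by blast
  qed (use cyc_edges_verts cycles[THEN is_cycle_nonempty] in \<open>unfold nt_verts_def, blast+\<close>)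
qed

lemma corner_in_side: "\<exists>q l. v = tv a b (corner q (l + 1))" if "v \<in> tside a b p k"
  using that unfolding tside_def
proof (elim insertE)
  assume "v = tv a b (corner p k)"
  moreover have "corner p k = corner p (k + 5 + 1)" by (rule corner_cong) simp
  ultimately show ?thesis by metis
qed (metis Suc_eq_plus1, simp)

lemma verts_corner: "\<exists>p k. v = tv a b (corner p (k + 1))" if "v \<in> verts"
proof -
  have *: "\<exists>p k. v = tv a b (corner p (k + 1))" if "is_cycle (tube_edges a b) Z" "v \<in> set Z" for Z
  proof -
    obtain i where "i < length Z" "v = Z ! i" using \<open>v \<in> set Z\<close> by (metis in_set_conv_nth)
    then have "v \<in> cyc_edge Z i" by (simp add: cyc_edge_def)
    moreover have "cyc_edge Z i \<in> tube_edges a b"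
      using that(1) cyc_edge_in[OF is_cycle_nonempty, of _ Z i] by (auto simp: is_cycle_def)
    ultimately show ?thesis using corner_in_side by (auto simp: tube_edges_def)
  qed
  consider "v \<in> set C1" | "v \<in> set C2" | p k where "v = tv a b (corner p k)"
    using \<open>v \<in> verts\<close> unfolding nt_verts_def by blast
  then show ?thesis
  proof cases
    case 3
    then have "v \<in> tside a b p k" by (simp add: tside_def)
    then show ?thesis by (rule corner_in_side)
  qed (use * cycles in blast)+
qed

lemma hex_sides: "tc a b p \<in> hexes \<Longrightarrow> tside a b p k \<in> edges"
  unfolding nt_edges_def by blast

lemma hex_corners: "tc a b p \<in> hexes \<Longrightarrow> tv a b (corner p k) \<in> verts"
  unfolding nt_verts_def by blast

lemma sides_at_corner_distinct:
  "tside a b p k \<noteq> tside a b (nbr p k) (k + 2)"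
  "tside a b p k \<noteq> tside a b p (k + 1)"
  "tside a b (nbr p k) (k + 2) \<noteq> tside a b p (k + 1)"
proof -
  have "k mod 6 \<noteq> (k + 2) mod 6" "(k + 3) mod 6 \<noteq> (k + 2) mod 6" "k mod 6 \<noteq> (k + 1) mod 6"
    "(k + 3) mod 6 \<noteq> (k + 1) mod 6" "(k + 2) mod 6 \<noteq> (k + 1) mod 6" "(k + 2 + 3) mod 6 \<noteq> (k + 1) mod 6"
    by (cases rule: residue_6[of k]; simp)+
  then show "tside a b p k \<noteq> tside a b (nbr p k) (k + 2)"
    "tside a b p k \<noteq> tside a b p (k + 1)"
    "tside a b (nbr p k) (k + 2) \<noteq> tside a b p (k + 1)"
    unfolding tside_eq_iff by blast+
qed

text \<open>
  The indicator of a matching on dual steps; on integers it turns "matched exactly once" into a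
  linear equation at each vertex.
\<close>
definition ind :: "tedge set \<Rightarrow> cell \<Rightarrow> nat \<Rightarrow> int" where
  "ind M p k = of_bool (tside a b p k \<in> M)"

lemma ind_bounds: "0 \<le> ind M p k" "ind M p k \<le> 1"
  by (simp_all add: ind_def)

lemma matched_once_iff:
  assumes "M \<subseteq> tube_edges a b"
  shows "(\<exists>!e. e \<in> M \<and> tv a b (corner p (k + 1)) \<in> e) \<longleftrightarrow>
    ind M p k + ind M (nbr p k) (k + 2) + ind M p (k + 1) = 1"
proof -
  have "e \<in> M \<and> tv a b (corner p (k + 1)) \<in> e \<longleftrightarrow> e \<in> M \<and>
    (e = tside a b p k \<or> e = tside a b (nbr p k) (k + 2) \<or> e = tside a b p (k + 1))" for e
    using assms edges_at_corner[of e a b p k] by blast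
  then show ?thesis
    using sides_at_corner_distinct[of p k] by (auto simp: ind_def simp del: nbr.simps corner.simps)
qed

lemma ind_nbr: "ind M (nbr p k) (k + 3) = ind M p k"
  unfolding ind_def tside_nbr ..

lemma matching_sum:
  assumes "pmatching M"
  shows "ind M p k + ind M (nbr p k) (k + 2) + ind M p (k + 1) =
    of_bool (tv a b (corner p (k + 1)) \<in> verts)"
proof -
  let ?v = "tv a b (corner p (k + 1))"
  have sub: "M \<subseteq> edges" using assms by (simp add: perfect_matching_def)
  then have tube: "M \<subseteq> tube_edges a b" using edges_tube by blast
  show ?thesis
  proof (cases "?v \<in> verts")
    case True
    then have "\<exists>!e. e \<in> M \<and> ?v \<in> e" using assms by (simp add: perfect_matching_def)
    then show ?thesis using True unfolding matched_once_iff[OF tube] by simp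
  next
    case False
    then have "e \<notin> M" if "?v \<in> e" for e
      using that sub edges_verts by blast
    then have "tside a b p k \<notin> M" "tside a b (nbr p k) (k + 2) \<notin> M" "tside a b p (k + 1) \<notin> M"
      using edges_at_corner[OF side_in_tube, of a b p k] by blast+
    then show ?thesis using False by (simp add: ind_def)
  qed
qed

lemma pmatchingI:
  assumes "M \<subseteq> edges"
    and "\<And>p k. tv a b (corner p (k + 1)) \<in> verts \<Longrightarrow>
      ind M p k + ind M (nbr p k) (k + 2) + ind M p (k + 1) = 1"
  shows "pmatching M"
  unfolding perfect_matching_def
proof (intro conjI ballI)
  have tube: "M \<subseteq> tube_edges a b" using edges_tube assms(1) by blast
  fix v assume v: "v \<in> verts"
  then obtain p k where pk: "v = tv a b (corner p (k + 1))" using verts_corner by blast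
  show "\<exists>!e. e \<in> M \<and> v \<in> e"
    using assms(2)[of p k] v unfolding pk matched_once_iff[OF tube] by blast
qed (fact assms)

lemma side_hex_iff:
  "tside a b q j \<in> {tside a b p k |k. k < 6} \<longleftrightarrow> tc a b q = tc a b p \<or> tc a b (nbr q j) = tc a b p"
proof
  assume "tside a b q j \<in> {tside a b p k |k. k < 6}"
  then show "tc a b q = tc a b p \<or> tc a b (nbr q j) = tc a b p" by (auto simp: tside_eq_iff)
next
  assume "tc a b q = tc a b p \<or> tc a b (nbr q j) = tc a b p"
  then have "tside a b q j = tside a b p (j mod 6) \<or> tside a b q j = tside a b p ((j + 3) mod 6)"
    unfolding tside_eq_iff by auto
  moreover have "j mod 6 < 6" "(j + 3) mod 6 < 6" by simp_all
  ultimately show "tside a b q j \<in> {tside a b p k |k. k < 6}" by blast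
qed

lemma ind_shift: "tc a b p = tc a b q \<Longrightarrow> ind M p k = ind M q k"
  unfolding ind_def by (metis tside_shift)

lemma ind_cong: "k mod 6 = l mod 6 \<Longrightarrow> ind M p k = ind M p l"
  unfolding ind_def by (metis tside_cong)

text \<open>
  Toggling the sides of \<open>p\<close> changes the indicator by plus or minus the difference of the indicator
  function of \<open>p\<close> along the dual step, with a sign depending only on the parity of the side. The
  three steps around a vertex have side numbers of equal parity and form a closed path, so the
  changes cancel there.
\<close>
lemma flip_matching:
  assumes M: "pmatching M" and p: "tc a b p \<in> hexes"
    and even: "tside a b p 0 \<in> M" "tside a b p 2 \<in> M" "tside a b p 4 \<in> M"
  defines "P \<equiv> {tside a b p k |k. k < 6}"
  defines "M' \<equiv> (M - P) \<union> (P - M)"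
  shows "pmatching M'" "(M, M') \<in> R6_adj a b C1 C2"
proof -
  have alt: "ind M p j = of_bool (even j)" for j
  proof -
    have e: "ind M p 0 = 1" "ind M p 2 = 1" "ind M p 4 = 1" using even by (simp_all add: ind_def)
    have "ind M p k + ind M p (k + 1) \<le> 1" for k
    proof -
      have "of_bool (tv a b (corner p (k + 1)) \<in> verts) \<le> (1::int)" by simp
      then show ?thesis using matching_sum[OF M, of p k] ind_bounds(1)[of M "nbr p k" "k + 2"] by linarith
    qed
    from this[of 0] this[of 2] this[of 4] have "ind M p 1 \<le> 0" "ind M p 3 \<le> 0" "ind M p 5 \<le> 0"
      using e by simp_all
    then have o: "ind M p 1 = 0" "ind M p 3 = 0" "ind M p 5 = 0"
      using ind_bounds(1)[of M p 1] ind_bounds(1)[of M p 3] ind_bounds(1)[of M p 5] by linarith+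
    have "ind M p j = ind M p (j mod 6)" by (rule ind_cong) simp
    then show ?thesis using e o by (cases rule: residue_6[of j]) simp_all
  qed
  have form: "ind M' q j = ind M q j -
    (-1) ^ j * (of_bool (tc a b q = tc a b p) - of_bool (tc a b (nbr q j) = tc a b p))" for q j
  proof -
    have P_iff: "tside a b q j \<in> P \<longleftrightarrow> tc a b q = tc a b p \<or> tc a b (nbr q j) = tc a b p"
      unfolding P_def by (rule side_hex_iff)
    consider "tc a b q = tc a b p" "tc a b (nbr q j) \<noteq> tc a b p"
      | "tc a b q \<noteq> tc a b p" "tc a b (nbr q j) = tc a b p"
      | "tc a b q \<noteq> tc a b p" "tc a b (nbr q j) \<noteq> tc a b p"
      using nbr_neq[of q j] by metis
    then show ?thesis
    proof cases
      case 1
      have "ind M q j = of_bool (even j)" using ind_shift[OF 1(1)] alt by simp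
      moreover have "ind M' q j = 1 - ind M q j" using P_iff 1 by (simp add: ind_def M'_def)
      ultimately show ?thesis using 1 by simp
    next
      case 2
      have "ind M q j = of_bool (odd j)"
        using ind_shift[OF 2(2), of M "j + 3"] alt[of "j + 3"] unfolding ind_nbr by simp
      moreover have "ind M' q j = 1 - ind M q j" using P_iff 2 by (simp add: ind_def M'_def)
      ultimately show ?thesis using 2 by simp
    next
      case 3
      then show ?thesis using P_iff by (simp add: ind_def M'_def)
    qed
  qed
  have sub: "P \<subseteq> edges" unfolding P_def using hex_sides[OF p] by blast
  moreover have "M \<subseteq> edges" using M by (simp add: perfect_matching_def)
  ultimately have "M' \<subseteq> edges" unfolding M'_def by blast
  then show M': "pmatching M'"
  proof (rule pmatchingI)
    fix q k assume v: "tv a b (corner q (k + 1)) \<in> verts"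
    show "ind M' q k + ind M' (nbr q k) (k + 2) + ind M' q (k + 1) = 1"
      using matching_sum[OF M, of q k] v
      unfolding form nbr_turn by (simp del: nbr.simps corner.simps)
  qed
  have "(M - M') \<union> (M' - M) = P" unfolding M'_def by blast
  then show "(M, M') \<in> R6_adj a b C1 C2"
    unfolding R6_adj_def P_def using M M' p by blast
qed

end

section \<open>The potential of two matchings\<close>

locale coloured_nanotube = nanotube +
  fixes col :: "tvert \<Rightarrow> colour"
  assumes colouring: "proper_colouring (nt_edges a b C1 C2) col"
begin

definition side_sign :: "cell \<Rightarrow> nat \<Rightarrow> int" where
  "side_sign p k = (if col (tv a b (corner p (k + 1))) = White then 1 else -1)"

definition jump :: "tedge set \<Rightarrow> tedge set \<Rightarrow> cell \<Rightarrow> nat \<Rightarrow> int" where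
  "jump M M' p k = side_sign p k * (ind M' p k - ind M p k)"

lemma colours_differ:
  "tside a b p k \<in> edges \<Longrightarrow> col (tv a b (corner p k)) \<noteq> col (tv a b (corner p (k + 1)))"
  using colouring unfolding proper_colouring_def tside_def by (metis Suc_eq_plus1)

lemma white_iff_not_white: "tside a b p k \<in> edges \<Longrightarrow>
    col (tv a b (corner p k)) = White \<longleftrightarrow> col (tv a b (corner p (k + 1))) \<noteq> White"
  using colours_differ[of p k] by (metis colour.exhaust)

lemma side_sign_nbr: "tside a b p k \<in> edges \<Longrightarrow> side_sign (nbr p k) (k + 3) = - side_sign p k"
  using white_iff_not_white[of p k] corner_nbr'[of p k]
  by (simp add: side_sign_def add.commute del: nbr.simps corner.simps)

lemma side_sign_Suc: "tside a b p (k + 1) \<in> edges \<Longrightarrow> side_sign p (k + 1) = - side_sign p k"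
  using white_iff_not_white[of p "k + 1"] by (simp add: side_sign_def del: nbr.simps corner.simps)

lemma side_sign_shift: "tc a b p = tc a b q \<Longrightarrow> side_sign p k = side_sign q k"
  unfolding side_sign_def by (metis tv_corner_shift)

lemma jump_shift: "tc a b p = tc a b q \<Longrightarrow> jump M M' p k = jump M M' q k"
  unfolding jump_def by (metis ind_shift side_sign_shift)

lemma jump_cong: "k mod 6 = l mod 6 \<Longrightarrow> jump M M' p k = jump M M' p l"
proof -
  assume k: "k mod 6 = l mod 6"
  then have "(k + 1) mod 6 = (l + 1) mod 6" by (metis mod_add_left_eq)
  then show ?thesis unfolding jump_def side_sign_def using ind_cong[OF k] corner_cong by metis
qed

lemma jump_off:
  assumes "pmatching M" "pmatching M'" "tside a b p k \<notin> edges"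
  shows "jump M M' p k = 0"
  using assms by (auto simp: perfect_matching_def jump_def ind_def)

lemma jump_nbr:
  assumes "pmatching M" "pmatching M'"
  shows "jump M M' (nbr p k) (k + 3) = - jump M M' p k"
proof (cases "tside a b p k \<in> edges")
  case True
  then show ?thesis by (simp add: jump_def side_sign_nbr ind_nbr del: nbr.simps)
next
  case False
  then have "tside a b (nbr p k) (k + 3) \<notin> edges" unfolding tside_nbr .
  then show ?thesis using jump_off[OF assms] False by simp
qed

text \<open>
  Around a vertex the three steps have that vertex on the same side, hence the same sign, and both
  matchings cover it equally often. So the jumps around it add up to zero, which is the statement
  with one of the three steps reversed.
\<close>
lemma jump_turn:
  assumes "pmatching M" "pmatching M'"
  shows "jump M M' p k + jump M M' (nbr p k) (k + 2) = jump M M' p (k + 1)"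
proof -
  let ?c = "side_sign p k"
  have 1: "jump M M' (nbr p k) (k + 2) = ?c * (ind M' (nbr p k) (k + 2) - ind M (nbr p k) (k + 2))"
    using corner_nbr[of p k] by (simp add: jump_def side_sign_def numeral_eq_Suc del: nbr.simps corner.simps)
  have 2: "jump M M' p (k + 1) = - ?c * (ind M' p (k + 1) - ind M p (k + 1))"
  proof (cases "tside a b p (k + 1) \<in> edges")
    case True
    then show ?thesis unfolding jump_def side_sign_Suc[OF True] by simp
  next
    case False
    then have "ind M' p (k + 1) = 0" "ind M p (k + 1) = 0"
      using assms by (auto simp: perfect_matching_def ind_def)
    then show ?thesis by (simp add: jump_def)
  qed
  have "(ind M' p k - ind M p k) + (ind M' (nbr p k) (k + 2) - ind M (nbr p k) (k + 2)) =
      - (ind M' p (k + 1) - ind M p (k + 1))"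
    using matching_sum[OF assms(1), of p k] matching_sum[OF assms(2), of p k] by linarith
  then have "?c * ((ind M' p k - ind M p k) + (ind M' (nbr p k) (k + 2) - ind M (nbr p k) (k + 2))) =
      ?c * - (ind M' p (k + 1) - ind M p (k + 1))"
    by (rule arg_cong)
  moreover have "jump M M' p k = ?c * (ind M' p k - ind M p k)" by (rule jump_def)
  ultimately show ?thesis
    unfolding 1 2 by (simp only: distrib_left mult_minus_left mult_minus_right)
qed

text \<open>
  A height difference of the two matchings: a function on the hexagons of the cylinder (given on the
  plane, constant on orbits) whose differences are the jumps.
\<close>
definition potential :: "tedge set \<Rightarrow> tedge set \<Rightarrow> (cell \<Rightarrow> int) \<Rightarrow> bool" where
  "potential M M' h \<longleftrightarrow> (\<forall>p q. tc a b p = tc a b q \<longrightarrow> h p = h q) \<and>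
     (\<forall>p k. h (nbr p k) = h p + jump M M' p k)"

text \<open>
  The edges that leave the flipped hexagon radially are unchanged, so the jumps out of it across any
  two consecutive sides agree. All six are equal, and the potential is concentrated at that hexagon.
\<close>
lemma flip_potential:
  assumes M: "pmatching M" "pmatching M'"
    and diff: "(M - M') \<union> (M' - M) = {tside a b p k |k. k < 6}"
  shows "potential M M' (\<lambda>q. - jump M M' p 0 * of_bool (tc a b q = tc a b p))"
proof -
  have changed: "tside a b q j \<in> M \<longleftrightarrow> tside a b q j \<in> M'"
    if "tc a b q \<noteq> tc a b p" "tc a b (nbr q j) \<noteq> tc a b p" for q j
    using that side_hex_iff[of q j p] unfolding diff[symmetric] by blast
  have "jump M M' p (k + 1) = jump M M' p k" for k
  proof -
    have "tc a b (nbr p k) \<noteq> tc a b p" "tc a b (nbr (nbr p k) (k + 2)) \<noteq> tc a b p"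
      using nbr_neq unfolding nbr_turn by blast+
    then have "jump M M' (nbr p k) (k + 2) = 0" using changed by (simp add: jump_def ind_def del: nbr.simps)
    then show ?thesis using jump_turn[OF M, of p k] by simp
  qed
  then have const: "jump M M' p k = jump M M' p 0" for k by (induction k) simp_all
  have "of_bool (tc a b (nbr q j) = tc a b p) * (- jump M M' p 0) =
    of_bool (tc a b q = tc a b p) * (- jump M M' p 0) + jump M M' q j" for q j
  proof -
    consider "tc a b q = tc a b p" "tc a b (nbr q j) \<noteq> tc a b p"
      | "tc a b q \<noteq> tc a b p" "tc a b (nbr q j) = tc a b p"
      | "tc a b q \<noteq> tc a b p" "tc a b (nbr q j) \<noteq> tc a b p"
      using nbr_neq[of q j] by metis
    then show ?thesis
    proof cases
      case 1
      have "jump M M' q j = jump M M' p 0" using jump_shift[OF 1(1)] const by metis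
      then show ?thesis using 1 by (simp del: nbr.simps)
    next
      case 2
      have "jump M M' q j = - jump M M' p 0"
        using jump_nbr[OF M, of q j] jump_shift[OF 2(2)] const by (metis minus_minus)
      then show ?thesis using 2 by (simp del: nbr.simps)
    next
      case 3
      then show ?thesis using changed by (simp add: jump_def ind_def del: nbr.simps)
    qed
  qed
  then show ?thesis unfolding potential_def by (simp add: mult.commute del: nbr.simps)
qed

end

section \<open>The two ends of the cylinder\<close>

text \<open>
  The coordinate along the axis of the cylinder, up to scaling: it vanishes on the translation.
\<close>
definition axial :: "int \<Rightarrow> int \<Rightarrow> cell \<Rightarrow> int" where
  "axial a b p = a * snd p - b * fst p"

lemma axial_shift: "tc a b p = tc a b q \<Longrightarrow> axial a b p = axial a b q"
  by (auto simp: tc_eq_iff axial_def algebra_simps)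

lemma axial_ray: "axial a b (ray p k t) = axial a b p + t * axial a b (nbr_vec k)"
  by (simp add: axial_def ray_def algebra_simps)

lemma cell_induct:
  assumes "P p" and step: "\<And>q k. P q \<Longrightarrow> P (nbr q k)"
  shows "P q"
proof -
  have *: "P (ray q k (int n))" if "P q" for q k n
  proof (induction n)
    case (Suc n)
    then have "P (nbr (ray q k (int n)) k)" by (rule step)
    then show ?case by (simp add: nbr_ray ray_ray add.commute)
  qed (use that in simp)
  define x y where "x = fst q - fst p" and "y = snd q - snd p"
  have "P (ray (ray p 5 (int (nat x))) 2 (int (nat (- x))))" by (intro * assms(1))
  then have "P (ray (ray (ray (ray p 5 (int (nat x))) 2 (int (nat (- x)))) 0 (int (nat y))) 3 (int (nat (- y))))"
    by (rule *[OF *])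
  moreover have "ray (ray (ray (ray p 5 (int (nat x))) 2 (int (nat (- x)))) 0 (int (nat y))) 3 (int (nat (- y))) = q"
    by (cases p, cases q) (simp add: x_def y_def ray_def nbr_vec_def)
  ultimately show ?thesis by simp
qed

lemma sym_crossing: "sym (crossing a b F)"
proof (rule symI)
  fix P Q assume "(P, Q) \<in> crossing a b F"
  then obtain p k where "P = tc a b p" "Q = tc a b (nbr p k)" "tside a b p k \<notin> F"
    unfolding crossing_def by blast
  then have "Q = tc a b (nbr p k)" "P = tc a b (nbr (nbr p k) (k + 3))" "tside a b (nbr p k) (k + 3) \<notin> F"
    unfolding nbr_back tside_nbr by auto
  then show "(Q, P) \<in> crossing a b F" unfolding crossing_def by blast
qed

lemma crossing_step: "tside a b p k \<notin> F \<Longrightarrow> (tc a b p, tc a b (nbr p k)) \<in> (crossing a b F)\<^sup>*"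
  unfolding crossing_def by blast

lemma region_eq_iff: "region a b F P = region a b F Q \<longleftrightarrow> (P, Q) \<in> (crossing a b F)\<^sup>*"
proof
  assume "region a b F P = region a b F Q"
  moreover have "Q \<in> region a b F Q" by (simp add: region_def)
  ultimately have "Q \<in> region a b F P" by simp
  then show "(P, Q) \<in> (crossing a b F)\<^sup>*" by (simp add: region_def)
next
  assume PQ: "(P, Q) \<in> (crossing a b F)\<^sup>*"
  then have "(Q, P) \<in> (crossing a b F)\<^sup>*" using sym_rtrancl[OF sym_crossing] by (metis symD)
  then show "region a b F P = region a b F Q"
    using PQ unfolding region_def by (auto intro: rtrancl_trans)
qed

lemma region_cells:
  assumes "Q \<in> region a b F (tc a b p)"
  obtains q where "Q = tc a b q"
proof -
  have "(tc a b p, Q) \<in> (crossing a b F)\<^sup>*" using assms by (simp add: region_def)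
  then have "\<exists>q. Q = tc a b q"
    by (induction rule: rtrancl_induct) (unfold crossing_def, blast+)
  then show ?thesis using that by blast
qed

text \<open>
  A band of bounded axial coordinate is a bounded piece of the cylinder. The translation reduces one
  plane coordinate modulo \<open>a\<close> or \<open>b\<close>, and the bound on \<open>axial\<close> then controls the other.
\<close>
lemma finite_band:
  assumes "(a, b) \<noteq> (0, 0)"
  shows "finite {tc a b p |p. \<bar>axial a b p\<bar> \<le> K}"
proof -
  define B where "B = \<bar>a\<bar> + \<bar>b\<bar> + \<bar>K\<bar> + \<bar>a\<bar> * \<bar>b\<bar>"
  have "{tc a b p |p. \<bar>axial a b p\<bar> \<le> K} \<subseteq> tc a b ` ({-B..B} \<times> {-B..B})"
  proof clarify
    fix i j assume K: "\<bar>axial a b (i, j)\<bar> \<le> K"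
    define n where "n = (if a = 0 then j div b else i div a)"
    define i' j' where "i' = i - n * a" and "j' = j - n * b"
    have eq: "tc a b (i, j) = tc a b (i', j')"
      unfolding tc_eq_iff i'_def j'_def by (intro exI[of _ "- n"]) simp
    then have K': "\<bar>a * j' - b * i'\<bar> \<le> \<bar>K\<bar>" using K axial_shift[OF eq] by (simp add: axial_def)
    have "\<bar>i'\<bar> \<le> B \<and> \<bar>j'\<bar> \<le> B"
    proof (cases "a = 0")
      case True
      then have "j' = j mod b" "b \<noteq> 0" using assms
        by (simp_all add: j'_def n_def minus_div_mult_eq_mod)
      then have j: "\<bar>j'\<bar> \<le> \<bar>b\<bar>" using abs_mod_less[of b j] by simp
      have "1 * \<bar>i'\<bar> \<le> \<bar>b\<bar> * \<bar>i'\<bar>" using \<open>b \<noteq> 0\<close> by (intro mult_right_mono) auto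
      also have "\<dots> \<le> \<bar>K\<bar>" using K' True by (simp add: abs_mult)
      finally show ?thesis using j unfolding B_def True by (simp, linarith)
    next
      case False
      then have "i' = i mod a" by (simp add: i'_def n_def minus_div_mult_eq_mod)
      then have i: "\<bar>i'\<bar> \<le> \<bar>a\<bar>" using abs_mod_less[of a i] False by simp
      have "1 * \<bar>j'\<bar> \<le> \<bar>a\<bar> * \<bar>j'\<bar>" using False by (intro mult_right_mono) auto
      also have "\<dots> = \<bar>(a * j' - b * i') + b * i'\<bar>" by (simp add: abs_mult)
      also have "\<dots> \<le> \<bar>a * j' - b * i'\<bar> + \<bar>b * i'\<bar>" by (rule abs_triangle_ineq)
      also have "\<bar>b * i'\<bar> \<le> \<bar>a\<bar> * \<bar>b\<bar>" unfolding abs_mult using i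
        by (metis abs_ge_zero mult.commute mult_right_mono)
      finally have "\<bar>j'\<bar> \<le> \<bar>K\<bar> + \<bar>a\<bar> * \<bar>b\<bar>" using K' by linarith
      moreover have "0 \<le> \<bar>a\<bar> * \<bar>b\<bar>" by simp
      ultimately show ?thesis using i unfolding B_def by linarith
    qed
    then show "tc a b (i, j) \<in> tc a b ` ({-B..B} \<times> {-B..B})"
      unfolding eq by (intro imageI) auto
  qed
  then show ?thesis by (rule finite_subset) simp
qed

context tube
begin

lemma axial_direction:
  assumes "s = 1 \<or> s = (-1::int)"
  obtains \<kappa> where "s * axial a b (nbr_vec \<kappa>) > 0"
proof -
  consider "a > 0" | "a < 0" | "a = 0" "b > 0" | "a = 0" "b < 0" using nonzero by fastforce
  then obtain \<kappa> where \<kappa>: "axial a b (nbr_vec \<kappa>) > 0"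
  proof cases
    case 1 then show thesis using that[of 0] by (simp add: axial_def nbr_vec_def)
  next
    case 2 then show thesis using that[of 3] by (simp add: axial_def nbr_vec_def)
  next
    case 3 then show thesis using that[of 2] by (simp add: axial_def nbr_vec_def)
  next
    case 4 then show thesis using that[of 5] by (simp add: axial_def nbr_vec_def)
  qed
  moreover have "axial a b (nbr_vec (\<kappa> + 3)) = - axial a b (nbr_vec \<kappa>)"
    by (cases rule: residue_6[of \<kappa>]) (simp_all add: axial_def nbr_vec_def)
  ultimately show ?thesis using assms that[of \<kappa>] that[of "\<kappa> + 3"] by auto
qed

lemma finite_edges_bounded:
  assumes "finite F"
  obtains K where "\<And>p k. tside a b p k \<in> F \<Longrightarrow> \<bar>axial a b p\<bar> \<le> K"
proof -
  have "finite {axial a b p |p k. tside a b p k = e}" for e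
  proof (cases "\<exists>q l. tside a b q l = e")
    case True
    then obtain q l where e: "tside a b q l = e" by blast
    have "{axial a b p |p k. tside a b p k = e} \<subseteq> {axial a b q, axial a b (nbr q l)}"
    proof
      fix x assume "x \<in> {axial a b p |p k. tside a b p k = e}"
      then obtain p k where x: "x = axial a b p" and "tside a b q l = tside a b p k" using e by blast
      then have "tc a b p = tc a b q \<or> tc a b p = tc a b (nbr q l)" unfolding tside_eq_iff by auto
      then show "x \<in> {axial a b q, axial a b (nbr q l)}" unfolding x using axial_shift by blast
    qed
    then show ?thesis by (rule finite_subset) simp
  next
    case False
    then have "{axial a b p |p k. tside a b p k = e} = {}" by blast
    then show ?thesis by (metis finite.emptyI)
  qed
  then have fin: "finite (\<Union>e\<in>F. {axial a b p |p k. tside a b p k = e})" (is "finite ?X")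
    using assms by blast
  have "\<bar>axial a b p\<bar> \<le> Max (abs ` ?X)" if "tside a b p k \<in> F" for p k
  proof (rule Max_ge)
    show "finite (abs ` ?X)" using fin by (rule finite_imageI)
    show "\<bar>axial a b p\<bar> \<in> abs ` ?X" by (rule imageI) (use that in blast)
  qed
  then show ?thesis using that by blast
qed

text \<open>
  Here \<open>s\<close> selects one end of the cylinder, walking in the direction \<open>\<kappa>\<close> leads towards it, and \<open>K\<close>
  bounds the part of the axis where \<open>F\<close> lies.
\<close>

context
  fixes F :: "tedge set" and K s :: int and \<kappa> :: nat
  assumes bound: "\<And>p k. tside a b p k \<in> F \<Longrightarrow> \<bar>axial a b p\<bar> \<le> K"
    and s: "s = 1 \<or> s = -1" and \<kappa>: "s * axial a b (nbr_vec \<kappa>) > 0"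
begin

lemma far_step: "K < s * axial a b p \<Longrightarrow> (tc a b p, tc a b (nbr p k)) \<in> (crossing a b F)\<^sup>*"
  using bound[of p k] s by (intro crossing_step) auto

lemma far_mono: "s * axial a b p + int n \<le> s * axial a b (ray p \<kappa> (int n))"
proof -
  have "int n * 1 \<le> int n * (s * axial a b (nbr_vec \<kappa>))" using \<kappa> by (intro mult_left_mono) auto
  then show ?thesis unfolding axial_ray by (simp add: algebra_simps)
qed

lemma far_ray:
  assumes "K < s * axial a b p"
  shows "(tc a b p, tc a b (ray p \<kappa> (int n))) \<in> (crossing a b F)\<^sup>*"
proof (induction n)
  case (Suc n)
  have "K < s * axial a b (ray p \<kappa> (int n))" using assms far_mono[of p n] by linarith
  then have "(tc a b (ray p \<kappa> (int n)), tc a b (nbr (ray p \<kappa> (int n)) \<kappa>)) \<in> (crossing a b F)\<^sup>*"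
    by (rule far_step)
  then show ?case using Suc.IH by (simp add: nbr_ray ray_ray add.commute)
qed simp

text \<open>
  Any walk between two cells meets \<open>F\<close> no more once it is pushed far enough along the axis, and far
  cells can be pushed freely.
\<close>
lemma far_connected:
  assumes p: "K < s * axial a b p" and q: "K < s * axial a b q"
  shows "(tc a b p, tc a b q) \<in> (crossing a b F)\<^sup>*"
proof -
  have "\<exists>N. \<forall>n\<ge>N. (tc a b (ray p \<kappa> (int n)), tc a b (ray q \<kappa> (int n))) \<in> (crossing a b F)\<^sup>*" (is "?R q")
  proof (rule cell_induct[of ?R p])
    fix q k assume "?R q"
    then obtain N where N: "\<And>n. n \<ge> N \<Longrightarrow>
        (tc a b (ray p \<kappa> (int n)), tc a b (ray q \<kappa> (int n))) \<in> (crossing a b F)\<^sup>*" by blast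
    show "?R (nbr q k)"
    proof (intro exI allI impI)
      fix n assume n: "n \<ge> max N (nat (K + 1 - s * axial a b q))"
      then have "K < s * axial a b (ray q \<kappa> (int n))" using far_mono[of q n] by linarith
      then have "(tc a b (ray q \<kappa> (int n)), tc a b (nbr (ray q \<kappa> (int n)) k)) \<in> (crossing a b F)\<^sup>*"
        by (rule far_step)
      moreover have "nbr (ray q \<kappa> (int n)) k = ray (nbr q k) \<kappa> (int n)"
        unfolding nbr_ray by (rule ray_commute)
      ultimately show "(tc a b (ray p \<kappa> (int n)), tc a b (ray (nbr q k) \<kappa> (int n))) \<in> (crossing a b F)\<^sup>*"
        using N[of n] n by (metis max.bounded_iff rtrancl_trans)
    qed
  qed blast
  then obtain n where "(tc a b (ray p \<kappa> (int n)), tc a b (ray q \<kappa> (int n))) \<in> (crossing a b F)\<^sup>*" by blast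
  moreover have "(tc a b (ray q \<kappa> (int n)), tc a b q) \<in> (crossing a b F)\<^sup>*"
    using far_ray[OF q] sym_rtrancl[OF sym_crossing] by (metis symD)
  ultimately show ?thesis using far_ray[OF p] by (meson rtrancl_trans)
qed

lemma far_infinite:
  assumes "K < s * axial a b p"
  shows "infinite (region a b F (tc a b p))"
proof -
  have "inj (\<lambda>n. tc a b (ray p \<kappa> (int n)))"
  proof (rule injI)
    fix m n assume "tc a b (ray p \<kappa> (int m)) = tc a b (ray p \<kappa> (int n))"
    then have "axial a b (ray p \<kappa> (int m)) = axial a b (ray p \<kappa> (int n))" by (rule axial_shift)
    then have "int m * axial a b (nbr_vec \<kappa>) = int n * axial a b (nbr_vec \<kappa>)" unfolding axial_ray by simp
    then show "m = n" using \<kappa> by auto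
  qed
  then have "infinite (range (\<lambda>n. tc a b (ray p \<kappa> (int n))))" using finite_imageD by blast
  moreover have "range (\<lambda>n. tc a b (ray p \<kappa> (int n))) \<subseteq> region a b F (tc a b p)"
    using far_ray[OF assms] by (auto simp: region_def)
  ultimately show ?thesis using finite_subset by blast
qed

end

lemma infinite_region_far:
  assumes "infinite (region a b F (tc a b p))"
  obtains q s where "s = 1 \<or> s = -1" "K < s * axial a b q"
    "region a b F (tc a b q) = region a b F (tc a b p)"
proof -
  have "\<not> region a b F (tc a b p) \<subseteq> {tc a b p |p. \<bar>axial a b p\<bar> \<le> K}"
    using assms finite_subset[OF _ finite_band[OF nonzero]] by blast
  then obtain Q where Q: "Q \<in> region a b F (tc a b p)" "Q \<notin> {tc a b p |p. \<bar>axial a b p\<bar> \<le> K}" by blast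
  obtain q where q: "Q = tc a b q" using Q(1) by (rule region_cells)
  then have "\<not> \<bar>axial a b q\<bar> \<le> K" using Q(2) by blast
  then have "K < 1 * axial a b q \<or> K < -1 * axial a b q" by linarith
  moreover have "(tc a b p, tc a b q) \<in> (crossing a b F)\<^sup>*"
    using Q(1) unfolding q by (simp add: region_def)
  then have "region a b F (tc a b q) = region a b F (tc a b p)" using region_eq_iff by blast
  ultimately show ?thesis using that by blast
qed

text \<open>
  The cylinder has two ends. An infinite region reaches arbitrarily far towards one of them, and far
  towards a given end all cells lie in one region.
\<close>
lemma at_most_two_infinite_regions:
  assumes "finite F"
    and "infinite (region a b F (tc a b p))" "infinite (region a b F (tc a b q))"
    and "infinite (region a b F (tc a b r))" "region a b F (tc a b p) \<noteq> region a b F (tc a b q)"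
  shows "region a b F (tc a b r) = region a b F (tc a b p) \<or>
    region a b F (tc a b r) = region a b F (tc a b q)"
proof -
  obtain K where K: "\<And>p k. tside a b p k \<in> F \<Longrightarrow> \<bar>axial a b p\<bar> \<le> K"
    using finite_edges_bounded[OF assms(1)] by blast
  have same: "region a b F (tc a b x) = region a b F (tc a b y)"
    if s: "s = 1 \<or> s = -1" and xy: "K < s * axial a b x" "K < s * axial a b y" for s x y
  proof -
    obtain \<kappa> where \<kappa>: "s * axial a b (nbr_vec \<kappa>) > 0" using axial_direction[OF s] .
    show ?thesis unfolding region_eq_iff by (rule far_connected[OF K s \<kappa> xy])
  qed
  obtain p' sp where p: "sp = 1 \<or> sp = -1" "K < sp * axial a b p'"
    "region a b F (tc a b p') = region a b F (tc a b p)"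
    using assms(2) by (rule infinite_region_far)
  obtain q' sq where q: "sq = 1 \<or> sq = -1" "K < sq * axial a b q'"
    "region a b F (tc a b q') = region a b F (tc a b q)"
    using assms(3) by (rule infinite_region_far)
  obtain r' sr where r: "sr = 1 \<or> sr = -1" "K < sr * axial a b r'"
    "region a b F (tc a b r') = region a b F (tc a b r)"
    using assms(4) by (rule infinite_region_far)
  have "sp \<noteq> sq" using same[OF p(1), of p' q'] p q assms(5) by metis
  then have "sr = sp \<or> sr = sq" using p(1) q(1) r(1) by auto
  then show ?thesis using same[OF r(1), of r' p'] same[OF r(1), of r' q'] p q r by metis
qed

end

context nanotube
begin

text \<open>
  Cells beyond the two bounding cycles can run off to infinity along the axis, so the cells with a
  finite region lie in a bounded band.
\<close>
lemma finite_hexes: "finite hexes"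
proof -
  let ?F = "cyc_edges C1 \<union> cyc_edges C2"
  have "finite ?F" by (simp add: cyc_edges_def)
  then obtain K where K: "\<And>p k. tside a b p k \<in> ?F \<Longrightarrow> \<bar>axial a b p\<bar> \<le> K"
    by (rule finite_edges_bounded) blast
  have "hexes \<subseteq> {tc a b p |p. \<bar>axial a b p\<bar> \<le> K}"
  proof
    fix P assume P: "P \<in> hexes"
    then obtain p where p: "P = tc a b p" by (auto simp: nt_hexagons_def tube_cells_def)
    have "\<bar>axial a b p\<bar> \<le> K"
    proof (rule ccontr)
      assume "\<not> \<bar>axial a b p\<bar> \<le> K"
      then have "K < 1 * axial a b p \<or> K < -1 * axial a b p" by linarith
      then obtain s :: int where s: "s = 1 \<or> s = -1" "K < s * axial a b p" by blast
      obtain \<kappa> where \<kappa>: "s * axial a b (nbr_vec \<kappa>) > 0" using axial_direction[OF s(1)] .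
      have "infinite (region a b ?F (tc a b p))" by (rule far_infinite[OF K s(1) \<kappa> s(2)])
      then show False using P p by (simp add: nt_hexagons_def)
    qed
    then show "P \<in> {tc a b p |p. \<bar>axial a b p\<bar> \<le> K}" using p by blast
  qed
  then show ?thesis using finite_band[OF nonzero] by (rule finite_subset)
qed

lemma finite_edges: "finite edges"
proof -
  have "finite {tside a b p k |p k. tc a b p = P}" for P
  proof (cases "\<exists>q. tc a b q = P")
    case True
    then obtain q where q: "tc a b q = P" by blast
    have "{tside a b p k |p k. tc a b p = P} \<subseteq> tside a b q ` {..<6}"
    proof clarify
      fix p k assume "P = tc a b p"
      then have "tside a b p k = tside a b q (k mod 6)" using q by (simp add: tside_eq_iff)
      then show "tside a b p k \<in> tside a b q ` {..<6}" by simp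
    qed
    then show ?thesis by (rule finite_subset) simp
  next
    case False
    then have "{tside a b p k |p k. tc a b p = P} = {}" by blast
    then show ?thesis by (metis finite.emptyI)
  qed
  then have fin: "finite (\<Union>P\<in>hexes. {tside a b p k |p k. tc a b p = P})"
    using finite_hexes by blast
  have "{tside a b p k |p k. tc a b p \<in> hexes} \<subseteq> (\<Union>P\<in>hexes. {tside a b p k |p k. tc a b p = P})"
    by blast
  from finite_subset[OF this fin] have "finite {tside a b p k |p k. tc a b p \<in> hexes}" .
  moreover have "finite (cyc_edges C1)" "finite (cyc_edges C2)" by (simp_all add: cyc_edges_def)
  ultimately show ?thesis unfolding nt_edges_def by (intro finite_UnI)
qed

abbreviation "face \<equiv> nt_face a b C1 C2"

lemma infinite_face_not_hex: "infinite (face p) \<Longrightarrow> tc a b p \<notin> hexes"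
proof
  assume inf: "infinite (face p)" and hex: "tc a b p \<in> hexes"
  have "Q = tc a b p" if "(tc a b p, Q) \<in> (crossing a b edges)\<^sup>*" for Q
    using that
  proof (induction rule: rtrancl_induct)
    case (step Q R)
    then show ?case using hex_sides[of _] hex unfolding crossing_def by auto
  qed simp
  then have "face p \<subseteq> {tc a b p}" by (auto simp: nt_face_def region_def)
  then have "finite (face p)" by (rule finite_subset) simp
  then show False using inf by blast
qed

text \<open>
  Cutting along all edges of the nanotube, and not only along the two cycles, does not cut the
  unbounded parts further: every further edge has cells of the nanotube on both sides.
\<close>
lemma infinite_face_off_hexes: "infinite (face p)" if p: "tc a b p \<notin> hexes"
proof -
  let ?F = "cyc_edges C1 \<union> cyc_edges C2"
  have outer: "tc a b q \<notin> hexes" if "(tc a b p, tc a b q) \<in> (crossing a b ?F)\<^sup>*" for q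
  proof -
    have "region a b ?F (tc a b q) = region a b ?F (tc a b p)"
      using that region_eq_iff by metis
    then show ?thesis using p by (simp add: nt_hexagons_def tube_cells_def)
  qed
  have "(tc a b p, Q) \<in> (crossing a b edges)\<^sup>*" if "(tc a b p, Q) \<in> (crossing a b ?F)\<^sup>*" for Q
    using that
  proof (induction rule: rtrancl_induct)
    case (step Q R)
    then obtain q k where q: "Q = tc a b q" "R = tc a b (nbr q k)" "tside a b q k \<notin> ?F"
      unfolding crossing_def by blast
    have "tc a b q \<notin> hexes" using outer step(1) unfolding q by blast
    moreover have "tc a b (nbr q k) \<notin> hexes"
      using outer step(1,2) unfolding q by (meson rtrancl.rtrancl_into_rtrancl)
    ultimately have "tside a b q k \<notin> edges"
      using q(3) unfolding nt_edges_def by (auto simp: tside_eq_iff)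
    then show ?case using step.IH crossing_step unfolding q by (meson rtrancl_trans)
  qed simp
  then have "region a b ?F (tc a b p) \<subseteq> face p" by (auto simp: nt_face_def region_def)
  moreover have "infinite (region a b ?F (tc a b p))"
    using p by (simp add: nt_hexagons_def tube_cells_def)
  ultimately show ?thesis using finite_subset by blast
qed

end

section \<open>Flow across a cut segment\<close>

context coloured_nanotube
begin

text \<open>
  Both matchings miss the edges outside the nanotube, so there the potential does not jump.
\<close>
lemma potential_crossing:
  assumes M: "pmatching M" "pmatching M'" and h: "potential M M' h"
    and "(tc a b p, tc a b q) \<in> (crossing a b edges)\<^sup>*"
  shows "h p = h q"
proof -
  have shift: "h x = h y" if "tc a b x = tc a b y" for x y
    using h that unfolding potential_def by blast
  have "\<forall>q. Q = tc a b q \<longrightarrow> h p = h q" if "(tc a b p, Q) \<in> (crossing a b edges)\<^sup>*" for Q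
    using that
  proof (induction rule: rtrancl_induct)
    case base
    then show ?case using shift by blast
  next
    case (step Q R)
    then obtain r k where r: "Q = tc a b r" "R = tc a b (nbr r k)" "tside a b r k \<notin> edges"
      unfolding crossing_def by blast
    have "h (nbr r k) = h r"
      using h jump_off[OF M r(3)] unfolding potential_def by (metis add_0_right)
    moreover have "h p = h r" using step.IH r(1) by blast
    ultimately show ?case using shift r(2) by metis
  qed
  then show ?thesis using assms(4) by blast
qed

lemma potential_face:
  assumes "pmatching M" "pmatching M'" "potential M M' h" "face p = face q"
  shows "h p = h q"
  using potential_crossing[OF assms(1-3)] assms(4) region_eq_iff unfolding nt_face_def by blast

end

locale cut_nanotube = coloured_nanotube +
  fixes L :: "(cell \<times> nat) list"
  assumes cut: "cut_segment a b C1 C2 L"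
begin

abbreviation "tail \<equiv> dual_tail a b C1 C2"
abbreviation "head \<equiv> dual_head a b C1 C2"

lemma cut_nonempty: "L \<noteq> []"
  using cut by (simp add: cut_segment_def)

lemma cut_edge: "x \<in> set L \<Longrightarrow> tside a b (fst x) (snd x) \<in> edges"
  using cut by (auto simp: cut_segment_def)

lemma cut_consecutive: "Suc i < length L \<Longrightarrow> tail (L ! Suc i) = head (L ! i)"
  using cut by (simp add: cut_segment_def)

lemma cut_distinct: "distinct (tail (hd L) # map head L)"
  using cut by (simp add: cut_segment_def)

lemma cut_infinite: "infinite (tail (hd L))" "infinite (head (last L))"
  using cut by (auto simp: cut_segment_def open_end_face_def)

lemma cut_ends_differ: "tail (hd L) \<noteq> head (last L)"
  using cut_distinct cut_nonempty by auto

lemma cut_faces_nth: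
  assumes "i < length L"
  shows "tail (L ! i) = (tail (hd L) # map head L) ! i"
    and "head (L ! i) = (tail (hd L) # map head L) ! Suc i"
  using assms cut_consecutive by (cases i; simp add: hd_conv_nth cut_nonempty)+

text \<open>
  A cut segment crosses no edge twice: the crossed edge determines the two faces up to order, and the
  faces along the segment are distinct.
\<close>
lemma cut_inj: "inj_on (\<lambda>x. tside a b (fst x) (snd x)) (set L)"
proof (rule inj_onI)
  let ?F = "tail (hd L) # map head L"
  fix x y assume "x \<in> set L" "y \<in> set L" and eq: "tside a b (fst x) (snd x) = tside a b (fst y) (snd y)"
  then obtain i j where i: "i < length L" "x = L ! i" and j: "j < length L" "y = L ! j"
    by (metis in_set_conv_nth)
  have F: "?F ! m = ?F ! n \<Longrightarrow> m = n" if "m \<le> length L" "n \<le> length L" for m n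
    using cut_distinct that nth_eq_iff_index_eq[of ?F m n] by simp
  have "tail x = tail y \<and> head x = head y \<or> tail x = head y \<and> head x = tail y"
  proof -
    from eq consider "tc a b (fst x) = tc a b (fst y)" "snd x mod 6 = snd y mod 6"
      | "tc a b (nbr (fst x) (snd x)) = tc a b (fst y)" "(snd x + 3) mod 6 = snd y mod 6"
      unfolding tside_eq_iff by blast
    then show ?thesis
    proof cases
      case 1
      then have "tc a b (nbr (fst x) (snd x)) = tc a b (nbr (fst y) (snd y))"
        using nbr_cong[OF 1(2)] tc_nbr_iff by metis
      then show ?thesis using 1(1) by (simp add: dual_tail_def dual_head_def nt_face_def del: nbr.simps)
    next
      case 2
      have "nbr (nbr (fst x) (snd x)) (snd y) = fst x"
        using nbr_cong[OF 2(2)] nbr_back by metis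
      then have "tc a b (nbr (fst y) (snd y)) = tc a b (fst x)"
        using 2(1) tc_nbr_iff by metis
      then show ?thesis using 2(1) by (simp add: dual_tail_def dual_head_def nt_face_def del: nbr.simps)
    qed
  qed
  then show "x = y"
    using F[of i j] F[of i "Suc j"] F[of "Suc i" j] i j unfolding i(2) j(2) cut_faces_nth[OF i(1)] cut_faces_nth[OF j(1)]
    by auto
qed

lemma cut_distinct_list: "distinct L"
  using cut_distinct by (simp add: distinct_map)

lemma flow_sum: "flow a b col L M = (\<Sum>(p, k)\<in>set L. side_sign p k * ind M p k)"
proof -
  let ?e = "\<lambda>x. tside a b (fst x) (snd x)"
  let ?W = "\<lambda>x. col (tv a b (corner (fst x) (snd x + 1))) = White"
  have pos: "cut_pos a b col L = ?e ` {x \<in> set L. ?W x}"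
    unfolding cut_pos_def image_def by force
  have neg: "cut_neg a b col L = ?e ` {x \<in> set L. \<not> ?W x}"
  proof -
    have "col (tv a b (corner (fst x) (snd x))) = White \<longleftrightarrow> \<not> ?W x" if "x \<in> set L" for x
      using white_iff_not_white[OF cut_edge[OF that]] .
    then show ?thesis unfolding cut_neg_def image_def by force
  qed
  have count: "int (card (?e ` {x \<in> set L. R x} \<inter> M)) = (\<Sum>x\<in>set L. of_bool (R x) * ind M (fst x) (snd x))" for R
  proof -
    have "?e ` {x \<in> set L. R x} \<inter> M = ?e ` {x \<in> set L. R x \<and> ?e x \<in> M}" by blast
    moreover have "card (?e ` {x \<in> set L. R x \<and> ?e x \<in> M}) = card {x \<in> set L. R x \<and> ?e x \<in> M}"
      by (rule card_image) (rule inj_on_subset[OF cut_inj], blast)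
    moreover have "int (card {x \<in> set L. R x \<and> ?e x \<in> M}) = (\<Sum>x\<in>set L. of_bool (R x \<and> ?e x \<in> M))"
      by (simp add: sum.If_cases of_bool_def Int_def)
    ultimately show ?thesis by (simp add: ind_def flip: of_bool_conj)
  qed
  show ?thesis
    unfolding flow_def pos neg count sum_subtractf[symmetric]
    by (intro sum.cong) (auto simp: side_sign_def)
qed

text \<open>
  Along the cut segment the jumps telescope, since the potential is constant on every face.
\<close>
lemma flow_potential:
  assumes M: "pmatching M" "pmatching M'" and h: "potential M M' h"
  shows "flow a b col L M' - flow a b col L M = h (nbr (fst (last L)) (snd (last L))) - h (fst (hd L))"
proof -
  \<comment> \<open>the values of \<open>h\<close> on the successive faces\<close>
  define H where "H i = (if i = 0 then h (fst (hd L)) else h (nbr (fst (L ! (i - 1))) (snd (L ! (i - 1)))))" for i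
  have tail: "h (fst (L ! i)) = H i" if "i < length L" for i
  proof (cases i)
    case (Suc j)
    then have "face (fst (L ! i)) = face (nbr (fst (L ! j)) (snd (L ! j)))"
      using cut_consecutive[of j] that by (simp add: dual_tail_def dual_head_def del: nbr.simps)
    from potential_face[OF M h this] show ?thesis using Suc by (simp add: H_def del: nbr.simps)
  qed (simp add: H_def hd_conv_nth cut_nonempty)
  have "flow a b col L M' - flow a b col L M = (\<Sum>x\<in>set L. jump M M' (fst x) (snd x))"
    unfolding flow_sum sum_subtractf[symmetric]
    by (intro sum.cong) (auto simp: jump_def algebra_simps)
  also have "\<dots> = (\<Sum>i<length L. jump M M' (fst (L ! i)) (snd (L ! i)))"
    using sum.reindex_bij_betw[OF bij_betw_nth[OF cut_distinct_list refl refl], of "\<lambda>x. jump M M' (fst x) (snd x)"]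
    by simp
  also have "\<dots> = (\<Sum>i<length L. H (Suc i) - H i)"
  proof (rule sum.cong)
    fix i assume "i \<in> {..<length L}"
    moreover have "h (nbr (fst (L ! i)) (snd (L ! i))) = h (fst (L ! i)) + jump M M' (fst (L ! i)) (snd (L ! i))"
      using h unfolding potential_def by blast
    ultimately show "jump M M' (fst (L ! i)) (snd (L ! i)) = H (Suc i) - H i"
      using tail[of i] by (simp add: H_def del: nbr.simps)
  qed simp
  also have "\<dots> = H (length L) - H 0" by (rule sum_lessThan_telescope)
  finally show ?thesis using cut_nonempty by (simp add: H_def last_conv_nth del: nbr.simps)
qed

text \<open>
  The two faces at the ends of the segment are all the infinite faces there are.
\<close>
lemma potential_off_hexes:
  assumes M: "pmatching M" "pmatching M'" and h: "potential M M' h" and p: "tc a b p \<notin> hexes"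
  shows "h p = h (fst (hd L)) \<or> h p = h (nbr (fst (last L)) (snd (last L)))"
proof -
  have "face p = face (fst (hd L)) \<or> face p = face (nbr (fst (last L)) (snd (last L)))"
    using cut_infinite cut_ends_differ infinite_face_off_hexes[OF p]
    unfolding dual_tail_def dual_head_def nt_face_def
    by (intro at_most_two_infinite_regions[OF finite_edges]) auto
  then show ?thesis using potential_face[OF M h] by blast
qed

lemma cut_ends_not_hex:
  "tc a b (fst (hd L)) \<notin> hexes" "tc a b (nbr (fst (last L)) (snd (last L))) \<notin> hexes"
  using cut_infinite infinite_face_not_hex unfolding dual_tail_def dual_head_def by blast+

end

section \<open>Existence of the potential\<close>

context coloured_nanotube
begin

text \<open>
  The jumps add up to zero around every vertex, so they have a primitive on the plane. Summing them
  along a straight ray to infinity (the sum is finite, because the nanotube is bounded along the axis)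
  gives a primitive which is visibly invariant under the translation; integrating from a base point
  would leave that open. The difference relation for one side next to the ray follows by pushing the
  ray sideways across rhombi, and for the remaining sides by turning around vertices.
\<close>
lemma potential_exists:
  assumes M: "pmatching M" "pmatching M'"
  shows "\<exists>h. potential M M' h"
proof -
  let ?D = "jump M M'"
  obtain K where K: "\<And>p k. tside a b p k \<in> edges \<Longrightarrow> \<bar>axial a b p\<bar> \<le> K"
    using finite_edges_bounded[OF finite_edges] by blast
  obtain \<kappa> where \<kappa>: "1 * axial a b (nbr_vec \<kappa>) > 0" by (rule axial_direction[of 1]) auto
  \<comment> \<open>after \<open>N p\<close> steps the ray from \<open>p\<close> has left the nanotube for good\<close>
  define N where "N p = nat (K + 1 + \<bar>axial a b p\<bar>)" for p
  have far: "?D (ray p \<kappa> (int n)) k = 0" if "n \<ge> N p" for p n k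
  proof (rule jump_off[OF M])
    have "axial a b p + int n \<le> axial a b (ray p \<kappa> (int n))"
      using far_mono[OF K _ \<kappa>, where p = p and n = n] by simp
    then have "K < axial a b (ray p \<kappa> (int n))" using that unfolding N_def by linarith
    then show "tside a b (ray p \<kappa> (int n)) k \<notin> edges" using K by fastforce
  qed
  define h where "h p = - (\<Sum>s<N p. ?D (ray p \<kappa> (int s)) \<kappa>)" for p
  have h: "h p = - (\<Sum>s<n. ?D (ray p \<kappa> (int s)) \<kappa>)" if "n \<ge> N p" for p n
    unfolding h_def neg_equal_iff_equal
    using that far by (intro sum.mono_neutral_left) auto
  have shift: "h p = h q" if pq: "tc a b p = tc a b q" for p q
  proof -
    have "?D (ray p \<kappa> t) \<kappa> = ?D (ray q \<kappa> t) \<kappa>" for t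
      by (rule jump_shift) (simp only: tc_ray_iff pq)
    then show ?thesis unfolding h_def N_def axial_shift[OF pq] by simp
  qed
  have step0: "h (nbr p \<kappa>) = h p + ?D p \<kappa>" for p
  proof -
    define n where "n = max (N p) (N (nbr p \<kappa>))"
    have "h p = - (\<Sum>s<Suc n. ?D (ray p \<kappa> (int s)) \<kappa>)" by (rule h) (simp add: n_def)
    also have "\<dots> = - (?D p \<kappa> + (\<Sum>s<n. ?D (ray p \<kappa> (int (Suc s))) \<kappa>))"
      unfolding sum.lessThan_Suc_shift by simp
    also have "(\<Sum>s<n. ?D (ray p \<kappa> (int (Suc s))) \<kappa>) = (\<Sum>s<n. ?D (ray (nbr p \<kappa>) \<kappa> (int s)) \<kappa>)"
      unfolding nbr_ray ray_ray by simp
    also have "\<dots> = - h (nbr p \<kappa>)" using h[of "nbr p \<kappa>" n] by (simp add: n_def)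
    finally show ?thesis by simp
  qed
  have step1: "h (nbr p (\<kappa> + 1)) = h p + ?D p (\<kappa> + 1)" for p
  proof -
    define n where "n = max (N p) (N (nbr p (\<kappa> + 1)))"
    have square: "?D q \<kappa> - ?D (nbr q (\<kappa> + 1)) \<kappa> = ?D q (\<kappa> + 1) - ?D (nbr q \<kappa>) (\<kappa> + 1)" for q
    proof -
      have "nbr (nbr q \<kappa>) (\<kappa> + 1) = nbr (nbr q (\<kappa> + 1)) \<kappa>" unfolding nbr_ray by (rule ray_commute)
      moreover have "\<kappa> + 1 + 1 = \<kappa> + 2" "\<kappa> + 1 + 2 = \<kappa> + 3" by simp_all
      ultimately show ?thesis
        using jump_turn[OF M, of q \<kappa>] jump_turn[OF M, of "nbr q \<kappa>" "\<kappa> + 1"]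
          jump_nbr[OF M, of "nbr q (\<kappa> + 1)" \<kappa>]
        by (simp only:)
    qed
    have "h (nbr p (\<kappa> + 1)) - h p = (\<Sum>s<n. ?D (ray p \<kappa> (int s)) \<kappa> - ?D (ray (nbr p (\<kappa> + 1)) \<kappa> (int s)) \<kappa>)"
      using h[of p n] h[of "nbr p (\<kappa> + 1)" n] by (simp add: n_def sum_subtractf del: nbr.simps)
    also have "\<dots> = (\<Sum>s<n. ?D (ray p \<kappa> (int s)) (\<kappa> + 1) - ?D (ray p \<kappa> (int (Suc s))) (\<kappa> + 1))"
    proof (intro sum.cong refl)
      fix s
      have "ray (nbr p (\<kappa> + 1)) \<kappa> (int s) = nbr (ray p \<kappa> (int s)) (\<kappa> + 1)"
        unfolding nbr_ray by (rule ray_commute)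
      moreover have "ray p \<kappa> (int (Suc s)) = nbr (ray p \<kappa> (int s)) \<kappa>"
        unfolding nbr_ray ray_ray by (simp add: add.commute)
      ultimately show "?D (ray p \<kappa> (int s)) \<kappa> - ?D (ray (nbr p (\<kappa> + 1)) \<kappa> (int s)) \<kappa> =
          ?D (ray p \<kappa> (int s)) (\<kappa> + 1) - ?D (ray p \<kappa> (int (Suc s))) (\<kappa> + 1)"
        using square by simp
    qed
    also have "\<dots> = ?D (ray p \<kappa> (int 0)) (\<kappa> + 1) - ?D (ray p \<kappa> (int n)) (\<kappa> + 1)"
      by (rule sum_lessThan_telescope')
    also have "\<dots> = ?D p (\<kappa> + 1)" using far[of p n] by (simp add: n_def)
    finally show ?thesis by simp
  qed
  have turn: "h (nbr p (k + 2)) = h p + ?D p (k + 2)"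
    if 0: "\<And>p. h (nbr p k) = h p + ?D p k" and 1: "\<And>p. h (nbr p (k + 1)) = h p + ?D p (k + 1)" for p k
  proof -
    let ?r = "nbr p (k + 1)"
    have e: "k + 1 + 1 = k + 2" "k + 1 + 2 = k + 3" by simp_all
    have n3: "nbr ?r (k + 3) = nbr p (k + 2)" using nbr_turn[of p "k + 1"] unfolding e .
    have d3: "?D p (k + 1) + ?D ?r (k + 3) = ?D p (k + 2)"
      using jump_turn[OF M, of p "k + 1"] unfolding e .
    have k6: "(k + 3 + 3) mod 6 = k mod 6" by simp
    have "nbr (nbr ?r (k + 3)) k = ?r"
      using nbr_back[of ?r "k + 3"] nbr_cong[OF k6, of "nbr ?r (k + 3)"] by metis
    moreover have "?D (nbr ?r (k + 3)) k = - ?D ?r (k + 3)"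
      using jump_nbr[OF M, of ?r "k + 3"] jump_cong[OF k6] by metis
    ultimately have "h ?r = h (nbr ?r (k + 3)) - ?D ?r (k + 3)"
      using 0[of "nbr ?r (k + 3)"] by simp
    then show ?thesis using 1[of p] d3 unfolding n3 by simp
  qed
  have steps: "(\<forall>p. h (nbr p (\<kappa> + n)) = h p + ?D p (\<kappa> + n)) \<and>
      (\<forall>p. h (nbr p (\<kappa> + n + 1)) = h p + ?D p (\<kappa> + n + 1))" for n
  proof (induction n)
    case 0
    then show ?case using step0 step1 by simp
  next
    case (Suc n)
    have e: "\<kappa> + Suc n = \<kappa> + n + 1" "\<kappa> + n + 1 + 1 = \<kappa> + n + 2" by simp_all
    show ?case using Suc turn[of "\<kappa> + n"] unfolding e by blast
  qed
  have "h (nbr p k) = h p + ?D p k" for p k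
  proof -
    \<comment> \<open>turning on from \<open>\<kappa>\<close> reaches a side number congruent to \<open>k\<close> modulo 6\<close>
    have "\<kappa> + (k + 5 * \<kappa>) = k + 6 * \<kappa>" by simp
    then have k: "(\<kappa> + (k + 5 * \<kappa>)) mod 6 = k mod 6" by simp
    have "h (nbr p (\<kappa> + (k + 5 * \<kappa>))) = h p + ?D p (\<kappa> + (k + 5 * \<kappa>))"
      using steps[of "k + 5 * \<kappa>"] by blast
    then show ?thesis unfolding nbr_cong[OF k] jump_cong[OF k] .
  qed
  then show ?thesis using shift unfolding potential_def by blast
qed

end

section \<open>Flips preserve ladders\<close>

lemma residues_3:
  fixes k :: nat
  shows "k mod 3 \<noteq> (k + 1) mod 3" "k mod 3 \<noteq> (k + 2) mod 3" "(k + 1) mod 3 \<noteq> (k + 2) mod 3"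
    "(k + 4) mod 3 = (k + 1) mod 3" "(k + 5) mod 3 = (k + 2) mod 3"
    "d < 3 \<Longrightarrow> d = k mod 3 \<or> d = (k + 1) mod 3 \<or> d = (k + 2) mod 3"
proof -
  have "d < 3 \<Longrightarrow> d = 0 \<or> d = 1 \<or> d = 2" by auto
  then show "d < 3 \<Longrightarrow> d = k mod 3 \<or> d = (k + 1) mod 3 \<or> d = (k + 2) mod 3"
    by (cases rule: residue_6[of k]) auto
qed (cases rule: residue_6[of k]; simp)+

context tube
begin

lemma has_direction_side: "has_direction a b (tside a b p k) (k mod 3)"
  unfolding has_direction_def by blast

lemma has_direction_up_edge:
  assumes "has_direction a b e d"
  obtains x where "e = up_edge a b x d" "d < 3"
proof -
  obtain p k where pk: "e = tside a b p k" "d = k mod 3" using assms by (auto simp: has_direction_def)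
  then have "e = up_edge a b (up_end p k) d" by (simp add: tside_up_edge up_edge_def dn_vec_def)
  then show ?thesis using that pk by simp
qed

lemma has_direction_unique: "has_direction a b e d \<Longrightarrow> has_direction a b e d' \<Longrightarrow> d = d'"
  by (metis has_direction_up_edge up_edge_eq_iff mod_less)

text \<open>
  The three edges at a vertex have different directions.
\<close>
lemma directed_edge_unique:
  assumes "has_direction a b e d" "has_direction a b e' d" "v \<in> e" "v \<in> e'"
  shows "e = e'"
proof -
  obtain x where x: "e = up_edge a b x d" using assms(1) by (rule has_direction_up_edge)
  obtain y where y: "e' = up_edge a b y d" using assms(2) by (rule has_direction_up_edge)
  consider "v = tv a b (Up (fst x) (snd x))" | "v = tv a b (Dn (fst x + fst (dn_vec d)) (snd x + snd (dn_vec d)))"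
    using assms(3) unfolding x up_edge_def by blast
  then have "tc a b y = tc a b x"
  proof cases
    case 1
    then show ?thesis using assms(4) unfolding y by (simp add: Up_in_up_edge)
  next
    case 2
    then show ?thesis using assms(4) unfolding y by (simp add: Dn_in_up_edge)
  qed
  then show ?thesis unfolding x y up_edge_eq_iff by simp
qed

end

context nanotube
begin

context
  fixes Z :: "tvert list" and M :: "tedge set" and d d' :: nat
  assumes Z: "is_cycle edges Z" "even (length Z)"
    and dirs: "\<And>i. i < length Z \<Longrightarrow> has_direction a b (cyc_edge Z i) (if even i then d else d')"
    and alt: "alternating M Z" and M: "pmatching M"
begin

text \<open>
  Both directions occur at every vertex of the ladder because the directions alternate along it.
\<close>
lemma ladder_vertex:
  assumes "v \<in> set Z"
  obtains e e' where "e \<in> cyc_edges Z" "e' \<in> cyc_edges Z" "v \<in> e" "v \<in> e'"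
    "has_direction a b e d" "has_direction a b e' d'" "e \<in> M \<or> e' \<in> M"
proof -
  let ?n = "length Z"
  have nz: "Z \<noteq> []" using Z(1) by (rule is_cycle_nonempty)
  then have pos: "0 < ?n" by simp
  obtain i where i: "i < ?n" "v = Z ! i" using assms by (metis in_set_conv_nth)
  \<comment> \<open>the cyclic predecessor of \<open>i\<close>\<close>
  let ?j = "i + ?n - 1"
  have Suc_j: "Suc ?j mod ?n = i" using i pos by (simp add: Suc_diff_1)
  have parity: "even (?j mod ?n) \<longleftrightarrow> odd i"
  proof -
    have "even (Suc ?j mod ?n) \<longleftrightarrow> odd (?j mod ?n)"
      using Z(2) by (metis even_Suc dvd_mod_iff)
    then show ?thesis unfolding Suc_j by blast
  qed
  let ?e = "cyc_edge Z i" and ?f = "cyc_edge Z (?j mod ?n)"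
  have e: "has_direction a b ?e (if even i then d else d')" using dirs i by blast
  have f: "has_direction a b ?f (if odd i then d else d')"
    using dirs[of "?j mod ?n"] pos unfolding parity by simp
  have v: "v \<in> ?e" "v \<in> ?f"
    using i Suc_j unfolding cyc_edge_mod by (simp_all add: cyc_edge_def)
  have "cyc_edge Z (Suc (?j mod ?n)) = ?e"
    using cyc_edge_mod[of Z "Suc (?j mod ?n)"] Suc_j by (simp add: mod_Suc_eq)
  then have "?f \<in> M \<or> ?e \<in> M"
    using alt pos unfolding alternating_def by (metis mod_less_divisor)
  moreover have "?e \<in> cyc_edges Z" "?f \<in> cyc_edges Z" using cyc_edge_in[OF nz] by blast+
  ultimately show ?thesis
    using that[of ?e ?f] that[of ?f ?e] e f v by (cases "even i") auto
qed

lemma ladder_matched_inside: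
  assumes "v \<in> set Z" "e \<in> M" "v \<in> e"
  shows "e \<in> cyc_edges Z" "has_direction a b e d \<or> has_direction a b e d'"
proof -
  obtain e1 e2 where e12: "e1 \<in> cyc_edges Z" "e2 \<in> cyc_edges Z" "v \<in> e1" "v \<in> e2"
    "has_direction a b e1 d" "has_direction a b e2 d'" "e1 \<in> M \<or> e2 \<in> M"
    using assms(1) by (rule ladder_vertex)
  have "v \<in> verts" using e12(1,3) Z(1) edges_verts unfolding is_cycle_def by blast
  then have "e = e1 \<or> e = e2"
    using M e12 assms unfolding perfect_matching_def by blast
  then show "e \<in> cyc_edges Z" "has_direction a b e d \<or> has_direction a b e d'" using e12 by blast+
qed

lemma ladder_has_directed:
  assumes "v \<in> set Z" "v \<in> e" "has_direction a b e d \<or> has_direction a b e d'"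
  shows "e \<in> cyc_edges Z"
proof -
  obtain e1 e2 where "e1 \<in> cyc_edges Z" "e2 \<in> cyc_edges Z" "v \<in> e1" "v \<in> e2"
    "has_direction a b e1 d" "has_direction a b e2 d'"
    using assms(1) by (rule ladder_vertex)
  then show ?thesis using directed_edge_unique assms(2,3) by metis
qed

text \<open>
  If a hexagon shared a side with a ladder, it would share two consecutive sides with it, meeting in
  the two directions of the ladder. The two sides of the hexagon next to these have the third
  direction and touch the ladder, so they are unmatched. But they are opposite to each other, and in
  an alternating hexagon one of two opposite sides is matched.
\<close>
lemma ladder_avoids_alternating_hexagon:
  assumes dd: "d \<noteq> d'" and hex: "\<And>k. tside a b p k \<in> M \<longleftrightarrow> tside a b p (k + 1) \<notin> M"
  shows "tside a b p k \<notin> cyc_edges Z"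
proof
  let ?s = "tside a b p"
  assume k: "?s k \<in> cyc_edges Z"
  have verts_Z: "e \<subseteq> set Z" if "e \<in> cyc_edges Z" for e
    using cyc_edges_verts[OF is_cycle_nonempty[OF Z(1)] that] .
  have inZ: "tv a b (corner p j) \<in> set Z \<and> tv a b (corner p (j + 1)) \<in> set Z" if "?s j \<in> cyc_edges Z" for j
    using verts_Z[OF that] by (simp add: tside_def)
  have c: "tv a b (corner p j) \<in> ?s j" "tv a b (corner p (j + 1)) \<in> ?s j" for j
    by (simp_all add: tside_def)
  have cong6: "?s (j + 6) = ?s j" "corner p (j + 6) = corner p j" for j
    by (intro tside_cong corner_cong; simp)+
  have not_M: False if "?s j \<in> M" "has_direction a b (?s j) t" "t \<noteq> d" "t \<noteq> d'"
    "tv a b (corner p j) \<in> set Z \<or> tv a b (corner p (j + 1)) \<in> set Z" for j t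
    using that ladder_matched_inside(2)[of _ "?s j"] c has_direction_unique by metis
  have hex3: "?s j \<in> M \<longleftrightarrow> ?s (j + 3) \<notin> M" for j
  proof -
    have e: "j + 1 + 1 = j + 2" "j + 2 + 1 = j + 3" by simp_all
    show ?thesis using hex[of j] hex[of "j + 1"] hex[of "j + 2"] unfolding e by blast
  qed
  have dk: "k mod 3 = d \<or> k mod 3 = d'"
  proof -
    obtain i where "i < length Z" "?s k = cyc_edge Z i" using k by (auto simp: cyc_edges_def)
    then show ?thesis using dirs has_direction_unique has_direction_side by metis
  qed
  have less: "d < 3" "d' < 3"
  proof -
    obtain e1 e2 where "has_direction a b e1 d" "has_direction a b e2 d'"
      using ladder_vertex inZ[OF k] by metis
    then show "d < 3" "d' < 3" by (auto elim: has_direction_up_edge)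
  qed
  have num: "k + 5 + 1 = k + 6" "k + 4 + 1 = k + 5" "k + 2 + 3 = k + 5" "k + 1 + 3 = k + 4" "k + 1 + 1 = k + 2"
    by simp_all
  show False
  proof (cases "(k + 1) mod 3 = d \<or> (k + 1) mod 3 = d'")
    case True
    have "?s (k + 1) \<in> cyc_edges Z"
      using ladder_has_directed[of "tv a b (corner p (k + 1))" "?s (k + 1)"] inZ[OF k] c True
        has_direction_side[of p "k + 1"] by metis
    then have 2: "tv a b (corner p (k + 2)) \<in> set Z" using inZ[of "k + 1"] unfolding num by blast
    have t: "(k + 2) mod 3 \<noteq> d" "(k + 2) mod 3 \<noteq> d'" 
      using True dk dd residues_3[of k] by metis+
    have "?s (k + 2) \<notin> M" (is ?not2) using not_M[of "k + 2"] has_direction_side[of p "k + 2"] t 2 by blast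
    have "has_direction a b (?s (k + 5)) ((k + 2) mod 3)" 
      using has_direction_side[of p "k + 5"] unfolding residues_3 .
    moreover have "tv a b (corner p (k + 5 + 1)) \<in> set Z" using inZ[OF k] unfolding num cong6 by blast
    ultimately have "?s (k + 5) \<notin> M" using not_M[of "k + 5"] t by blast
    then show False using \<open>?not2\<close> hex3[of "k + 2"] unfolding num by blast
  next
    case False
    have k2: "(k + 5) mod 3 = d \<or> (k + 5) mod 3 = d'" 
      using False dk dd residues_3(6)[OF less(1), of k] residues_3(6)[OF less(2), of k]
      unfolding residues_3 by metis
    have 6: "tv a b (corner p (k + 5 + 1)) \<in> set Z" using inZ[OF k] unfolding num cong6 by blast
    then have "?s (k + 5) \<in> cyc_edges Z"
      using ladder_has_directed[OF 6 c(2)] k2 has_direction_side[of p "k + 5"] by metis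
    then have 5: "tv a b (corner p (k + 4 + 1)) \<in> set Z" using inZ[of "k + 5"] unfolding num by blast
    have "has_direction a b (?s (k + 4)) ((k + 1) mod 3)"
      using has_direction_side[of p "k + 4"] unfolding residues_3 .
    then have "?s (k + 4) \<notin> M" using not_M[of "k + 4"] 5 False by blast
    moreover have "?s (k + 1) \<notin> M"
      using not_M[of "k + 1"] has_direction_side[of p "k + 1"] False inZ[OF k] by blast
    ultimately show False using hex3[of "k + 1"] unfolding num by blast
  qed
qed

end

lemma flip_alternates:
  assumes M: "pmatching M" "pmatching M'" and p: "tc a b p \<in> hexes"
    and diff: "(M - M') \<union> (M' - M) = {tside a b p k |k. k < 6}"
  shows "tside a b p k \<in> M \<longleftrightarrow> tside a b p (k + 1) \<notin> M"
proof -
  have on: "ind M' p j = 1 - ind M p j" for j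
    using side_hex_iff[of p j p] unfolding diff[symmetric] ind_def by auto
  have "tc a b (nbr p k) \<noteq> tc a b p" "tc a b (nbr (nbr p k) (k + 2)) \<noteq> tc a b p"
    using nbr_neq unfolding nbr_turn by blast+
  then have "tside a b (nbr p k) (k + 2) \<in> M \<longleftrightarrow> tside a b (nbr p k) (k + 2) \<in> M'"
    using side_hex_iff[of "nbr p k" "k + 2" p] unfolding diff[symmetric] by blast
  then have off: "ind M' (nbr p k) (k + 2) = ind M (nbr p k) (k + 2)" by (simp add: ind_def)
  have "ind M p k + ind M p (k + 1) = 1"
    using matching_sum[OF M(1), of p k] matching_sum[OF M(2), of p k] ind_bounds(1)[of M "nbr p k" "k + 2"]
      hex_corners[OF p, of "k + 1"] unfolding on off by simp
  then show ?thesis by (auto simp: ind_def split: if_splits)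
qed

lemma R6_adj_sym: "(M, M') \<in> R6_adj a b C1 C2 \<Longrightarrow> (M', M) \<in> R6_adj a b C1 C2"
  unfolding R6_adj_def by (auto simp: Un_commute)

lemma R6_adj_ladder:
  assumes "(M, M') \<in> R6_adj a b C1 C2" and "zigzag_cycle a b edges Z" and alt: "alternating M Z"
  shows "M \<inter> cyc_edges Z = M' \<inter> cyc_edges Z" "alternating M' Z"
proof -
  obtain p where M: "pmatching M" "pmatching M'" and p: "tc a b p \<in> hexes"
    and diff: "(M - M') \<union> (M' - M) = {tside a b p k |k. k < 6}"
    using assms(1) unfolding R6_adj_def by blast
  obtain d d' where Z: "is_cycle edges Z" "even (length Z)" "d \<noteq> d'"
    "\<And>i. i < length Z \<Longrightarrow> has_direction a b (cyc_edge Z i) (if even i then d else d')"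
    using assms(2) unfolding zigzag_cycle_def by blast
  have "tside a b p k \<notin> cyc_edges Z" for k
    by (rule ladder_avoids_alternating_hexagon[OF Z(1,2,4) alt M(1) Z(3)])
      (assumption, rule flip_alternates[OF M p diff])
  then have "{tside a b p k |k. k < 6} \<inter> cyc_edges Z = {}" by blast
  then show eq: "M \<inter> cyc_edges Z = M' \<inter> cyc_edges Z" unfolding diff[symmetric] by blast
  show "alternating M' Z"
    using alt eq cyc_edge_in[OF is_cycle_nonempty[OF Z(1)]] unfolding alternating_def by blast
qed

lemma R6_adj_same_ladders:
  assumes "(M, M') \<in> R6_adj a b C1 C2"
  shows "same_ladders a b edges M M'"
  unfolding same_ladders_def
proof (intro allI impI conjI iffI)
  fix Z assume Z: "zigzag_cycle a b edges Z"
  show "alternating M' Z" if "alternating M Z" by (rule R6_adj_ladder(2)[OF assms Z that])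
  show "alternating M Z" if "alternating M' Z"
    by (rule R6_adj_ladder(2)[OF R6_adj_sym[OF assms] Z that])
  show "M \<inter> cyc_edges Z = M' \<inter> cyc_edges Z" if "alternating M Z"
    by (rule R6_adj_ladder(1)[OF assms Z that])
qed

lemma same_ladders_sym: "same_ladders a b E M M' \<Longrightarrow> same_ladders a b E M' M"
  unfolding same_ladders_def by blast

lemma same_ladders_trans:
  "same_ladders a b E M M' \<Longrightarrow> same_ladders a b E M' M'' \<Longrightarrow> same_ladders a b E M M''"
  unfolding same_ladders_def by blast

end

section \<open>Finding a hexagon to flip\<close>

lemma ray_nbr: "nbr (ray p k t) k = ray p k (t + 1)"
  unfolding nbr_ray ray_ray ..

lemma corner_parity:
  "even m \<Longrightarrow> \<exists>i j. corner p m = Up i j" "odd m \<Longrightarrow> \<exists>i j. corner p m = Dn i j"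
  by (cases p, cases rule: residue_6[of m]; simp)+

lemma tv_corner_iff: "tv a b (corner p m) = tv a b (corner q m) \<longleftrightarrow> tc a b p = tc a b q"
proof
  assume *: "tv a b (corner p m) = tv a b (corner q m)"
  have "\<exists>x y. tc a b (fst p + x, snd p + y) = tc a b (fst q + x, snd q + y)"
    using * by (cases p, cases q, cases rule: residue_6[of m])
      (simp_all, (metis add_0_right diff_conv_add_uminus)+)
  then show "tc a b p = tc a b q" by (simp add: tc_shift_iff)
qed (rule tv_corner_shift)

text \<open>
  Even corners are of the form \<open>Up\<close> and odd corners of the form \<open>Dn\<close>.
\<close>
lemma tv_corner_parity:
  assumes "even m" "odd n"
  shows "tv a b (corner p m) \<noteq> tv a b (corner q n)"
  using corner_parity(1)[OF assms(1), of p] corner_parity(2)[OF assms(2), of q] by auto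

context nanotube
begin

lemma hex_sum:
  assumes "pmatching M" "tc a b p \<in> hexes"
  shows "ind M p k + ind M (nbr p k) (k + 2) + ind M p (k + 1) = 1"
  using matching_sum[OF assms(1), of p k] hex_corners[OF assms(2), of "k + 1"] by simp

lemma not_in_iff_ind: "tside a b p k \<notin> M \<longleftrightarrow> ind M p k = 0"
  by (simp add: ind_def)

lemma hex_vertex_third:
  assumes "pmatching M" "tc a b p \<in> hexes"
  shows "ind M p k = 0 \<Longrightarrow> ind M (nbr p k) (k + 2) = 0 \<Longrightarrow> ind M p (k + 1) = 1"
    and "ind M p (k + 1) = 0 \<Longrightarrow> ind M (nbr p k) (k + 2) = 0 \<Longrightarrow> ind M p k = 1"
    and "ind M p k = 1 \<Longrightarrow> ind M (nbr p k) (k + 2) = 0 \<and> ind M p (k + 1) = 0"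
    and "ind M p (k + 1) = 1 \<Longrightarrow> ind M (nbr p k) (k + 2) = 0 \<and> ind M p k = 0"
  using hex_sum[OF assms, of k] ind_bounds[of M p k] ind_bounds[of M p "k + 1"]
    ind_bounds[of M "nbr p k" "k + 2"] by linarith+

text \<open>
  The set \<open>S\<close> stands for the hexagons with the maximal potential, as seen from the one of the two
  matchings for which an unmatched even side means that the potential does not decrease across it.
  An edge on which the matchings agree carries no jump at all.
\<close>

context
  fixes M M' :: "tedge set" and S :: "cell set"
  assumes M: "pmatching M"
    and S_hex: "\<And>p. p \<in> S \<Longrightarrow> tc a b p \<in> hexes"
    and S_shift: "\<And>p q. p \<in> S \<Longrightarrow> tc a b p = tc a b q \<Longrightarrow> q \<in> S"
    and S_even: "\<And>p k. p \<in> S \<Longrightarrow> even k \<Longrightarrow> tside a b p k \<notin> M \<Longrightarrow> nbr p k \<in> S"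
    and S_agree: "\<And>p k. p \<in> S \<Longrightarrow> tside a b p k \<in> M \<longleftrightarrow> tside a b p k \<in> M' \<Longrightarrow> nbr p k \<in> S"
    and ladders: "same_ladders a b edges M M'"
begin

text \<open>
  For even \<open>k\<close>, crossing such a side leads to a cell of \<open>S\<close> again.
\<close>
definition pass :: "nat \<Rightarrow> cell \<Rightarrow> bool" where
  "pass k p \<longleftrightarrow> p \<in> S \<and> tside a b p k \<notin> M"

lemma pass_cong: "k mod 6 = l mod 6 \<Longrightarrow> pass k p \<longleftrightarrow> pass l p"
  unfolding pass_def by (simp only: tside_cong[of k l])

lemma pass_shift: "tc a b p = tc a b q \<Longrightarrow> pass k p \<Longrightarrow> pass k q"
  unfolding pass_def using S_shift tside_shift by metis

text \<open>
  The two steps cross two of the three edges at a common vertex, so the third edge there is matched.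
  The short diagonal of the rhombus spanned by the two steps crosses that edge. At its other end the two
  remaining edges are unmatched, and these are crossed by the other way around the rhombus.
\<close>
lemma pass_commute_2:
  assumes k: "even k" and p: "pass k p" and q: "pass (k + 2) (nbr p k)"
  shows "pass (k + 2) p \<and> pass k (nbr p (k + 2))"
proof -
  have S: "p \<in> S" using p by (simp add: pass_def)
  note hex = M S_hex[OF S]
  have e: "k + 1 + 1 = k + 2" "k + 1 + 2 = k + 3" by simp_all
  have "ind M p (k + 1) = 1"
    using p q unfolding pass_def not_in_iff_ind by (intro hex_vertex_third(1)[OF hex]) blast+
  from hex_vertex_third(3)[OF hex this]
  have 0: "ind M (nbr p (k + 1)) (k + 3) = 0" "ind M p (k + 2) = 0" unfolding e by blast+
  have "nbr (nbr p (k + 1)) (k + 3) = nbr p (k + 2)" using nbr_turn[of p "k + 1"] unfolding e .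
  then have "ind M (nbr p (k + 2)) (k + 3 + 3) = 0" using 0(1) ind_nbr[of M "nbr p (k + 1)" "k + 3"] by simp
  moreover have "ind M (nbr p (k + 2)) (k + 3 + 3) = ind M (nbr p (k + 2)) k" by (rule ind_cong) simp
  moreover have "nbr p (k + 2) \<in> S" using S_even[OF S, of "k + 2"] k 0(2) unfolding not_in_iff_ind by simp
  ultimately show ?thesis using 0(2) S unfolding pass_def not_in_iff_ind by simp
qed

text \<open>
  The same rhombus as before, traversed with the common vertex on the right.
\<close>
lemma pass_commute_4:
  assumes k: "even k" and p: "pass k p" and q: "pass (k + 4) (nbr p k)"
  shows "pass (k + 4) p \<and> pass k (nbr p (k + 4))"
proof -
  have S: "p \<in> S" using p by (simp add: pass_def)
  note hex = M S_hex[OF S]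
  have e: "k + 4 + 1 = k + 5" "k + 4 + 2 = k + 6" "k + 5 + 1 = k + 6" "k + 5 + 2 = k + 7" "k + 4 + 3 = k + 7"
    by simp_all
  have k6: "(k + 6) mod 6 = k mod 6" by simp
  have "nbr (nbr p k) (k + 4) = nbr (nbr p (k + 4)) k" unfolding nbr_ray by (rule ray_commute)
  also have "\<dots> = nbr p (k + 5)"
    using nbr_turn[of p "k + 4"] nbr_cong[OF k6] unfolding e by metis
  finally have "ind M (nbr p (k + 5)) (k + 7) = ind M (nbr p k) (k + 4)"
    using ind_nbr[of M "nbr p k" "k + 4"] unfolding e by simp
  then have "ind M (nbr p (k + 5)) (k + 7) = 0" using q by (simp add: pass_def not_in_iff_ind)
  moreover have "ind M p (k + 6) = 0"
    using p ind_cong[OF k6, of M p] by (simp add: pass_def not_in_iff_ind)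
  ultimately have "ind M p (k + 5) = 1" using hex_vertex_third(2)[OF hex, of "k + 5"] unfolding e by blast
  then have 0: "ind M (nbr p (k + 4)) (k + 6) = 0" "ind M p (k + 4) = 0"
    using hex_vertex_third(4)[OF hex, of "k + 4"] unfolding e by blast+
  have "ind M (nbr p (k + 4)) k = 0" using 0(1) unfolding ind_cong[OF k6] .
  moreover have "nbr p (k + 4) \<in> S" using S_even[OF S, of "k + 4"] k 0(2) unfolding not_in_iff_ind by simp
  ultimately show ?thesis using 0(2) S unfolding pass_def not_in_iff_ind by simp
qed

lemma pass_commute:
  assumes "k \<in> {0, 2, 4}" "j \<in> {0, 2, 4}" "k \<noteq> j" "pass k p" "pass j (nbr p k)"
  shows "pass j p \<and> pass k (nbr p j)"
proof -
  have k: "even k" using assms(1) by auto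
  have "j mod 6 = (k + 2) mod 6 \<or> j mod 6 = (k + 4) mod 6" using assms(1-3) by auto
  then show ?thesis
  proof
    assume j: "j mod 6 = (k + 2) mod 6"
    then show ?thesis
      using pass_commute_2[OF k assms(4)] assms(5) pass_cong[OF j] nbr_cong[OF j, of p] by simp
  next
    assume j: "j mod 6 = (k + 4) mod 6"
    then show ?thesis
      using pass_commute_4[OF k assms(4)] assms(5) pass_cong[OF j] nbr_cong[OF j, of p] by simp
  qed
qed

definition straight :: "nat \<Rightarrow> nat \<Rightarrow> cell \<Rightarrow> bool" where
  "straight k n p \<longleftrightarrow> (\<forall>t<n. pass k (ray p k (int t)))"

lemma straight_Suc:
  assumes "pass k p" "straight k n (nbr p k)"
  shows "straight k (Suc n) p"
  unfolding straight_def
proof (intro allI impI)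
  fix t assume "t < Suc n"
  then show "pass k (ray p k (int t))"
    using assms by (cases t) (simp_all add: straight_def nbr_ray ray_ray add.commute)
qed

lemma straight_commute:
  assumes "k \<in> {0, 2, 4}" "j \<in> {0, 2, 4}" "k \<noteq> j" "pass k p" "straight j n (nbr p k)"
  shows "straight j n p"
proof -
  have step: "pass j (ray p j (int t)) \<and> pass k (ray p j (int (Suc t)))"
    if "pass k (ray p j (int t))" "t < n" for t
  proof -
    have "pass j (ray (nbr p k) j (int t))" using assms(5) that(2) by (simp add: straight_def)
    moreover have "ray (nbr p k) j (int t) = nbr (ray p j (int t)) k"
      unfolding nbr_ray by (rule ray_commute)
    ultimately show ?thesis
      using pass_commute[OF assms(1-3) that(1)] unfolding ray_nbr by (simp add: add.commute)
  qed
  have "pass k (ray p j (int t))" if "t \<le> n" for t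
    using that by (induction t) (use assms(4) step in auto)
  then show ?thesis unfolding straight_def using step by simp
qed

text \<open>
  Since steps in different directions can be exchanged, a long passable walk can be sorted: the steps
  in any one direction can all be made first.
\<close>
lemma straight_runs:
  assumes move: "\<And>p. p \<in> S \<Longrightarrow> \<exists>k\<in>{0, 2, 4}. tside a b p k \<notin> M" and "p \<in> S"
  shows "\<exists>f. f 0 + f 2 + f 4 = n \<and> (\<forall>j\<in>{0, 2, 4}. straight j (f j) p)"
  using assms(2)
proof (induction n arbitrary: p)
  case 0
  show ?case by (rule exI[of _ "\<lambda>_. 0"]) (simp add: straight_def)
next
  case (Suc n)
  obtain k where k: "k \<in> {0, 2, 4}" "tside a b p k \<notin> M" using move Suc.prems by blast
  then have pass: "pass k p" using Suc.prems by (simp add: pass_def)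
  have "nbr p k \<in> S" using S_even[OF Suc.prems _ k(2)] k(1) by auto
  then obtain f where f: "f 0 + f 2 + f 4 = n" "\<forall>j\<in>{0, 2, 4}. straight j (f j) (nbr p k)"
    using Suc.IH by blast
  let ?g = "f(k := Suc (f k))"
  have "straight j (?g j) p" if j: "j \<in> {0, 2, 4}" for j
    using straight_Suc[OF pass] straight_commute[OF k(1) j _ pass] f(2) j by (cases "j = k") auto
  moreover have "?g 0 + ?g 2 + ?g 4 = Suc n" using f(1) k(1) by auto
  ultimately show ?case by blast
qed

lemma finite_S_cells: "finite (tc a b ` S)"
  using finite_subset[OF _ finite_hexes] S_hex by blast

text \<open>
  A straight walk longer than the number of cells in \<open>S\<close> revisits a cell of the cylinder. So the
  translation is a multiple of the direction of the walk, and the walk closes up to a full row.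
\<close>
lemma straight_row:
  assumes k: "k \<in> {0, 2, 4}" and n: "card (tc a b ` S) < n" "\<bar>a\<bar> + \<bar>b\<bar> \<le> int n" and st: "straight k n p"
  obtains c where "a = c * fst (nbr_vec k)" "b = c * snd (nbr_vec k)" "\<And>t. pass k (ray p k t)"
proof -
  have "\<not> inj_on (\<lambda>t. tc a b (ray p k (int t))) {..<n}"
  proof
    assume "inj_on (\<lambda>t. tc a b (ray p k (int t))) {..<n}"
    then have "card ((\<lambda>t. tc a b (ray p k (int t))) ` {..<n}) = n" by (simp add: card_image)
    moreover have "(\<lambda>t. tc a b (ray p k (int t))) ` {..<n} \<subseteq> tc a b ` S"
      using st unfolding straight_def pass_def by blast
    ultimately show False using n(1) card_mono[OF finite_S_cells] by (metis leD)
  qed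
  then obtain s t :: nat where st': "s \<noteq> t" "tc a b (ray p k (int s)) = tc a b (ray p k (int t))"
    unfolding inj_on_def by blast
  then obtain m where "fst (ray p k (int t)) = fst (ray p k (int s)) + m * a"
    "snd (ray p k (int t)) = snd (ray p k (int s)) + m * b"
    unfolding tc_eq_iff by blast
  then have m: "(int t - int s) * fst (nbr_vec k) = m * a" "(int t - int s) * snd (nbr_vec k) = m * b"
    by (simp_all add: ray_def left_diff_distrib)
  have m0: "m \<noteq> 0" using m st'(1) nbr_vec_small(4)[of k] by auto
  obtain c where c: "a = c * fst (nbr_vec k)" "b = c * snd (nbr_vec k)"
  proof -
    consider "k = 0" | "k = 2" | "k = 4" using k by blast
    then show thesis
    proof cases
      case 1
      then have "a = 0" using m(1) m0 by (simp add: nbr_vec_def)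
      then show thesis using 1 that[of b] by (simp add: nbr_vec_def)
    next
      case 2
      then have "b = 0" using m(2) m0 by (simp add: nbr_vec_def)
      then show thesis using 2 that[of "- a"] by (simp add: nbr_vec_def)
    next
      case 3
      then have "m * (a + b) = 0" using m by (simp add: nbr_vec_def algebra_simps)
      then show thesis using 3 m0 that[of a] by (simp add: nbr_vec_def eq_neg_iff_add_eq_0 add.commute)
    qed
  qed
  have c0: "c \<noteq> 0" using c nonzero by auto
  have cn: "\<bar>c\<bar> \<le> int n"
  proof -
    consider "k = 0" | "k = 2" | "k = 4" using k by blast
    then have "\<bar>c\<bar> \<le> \<bar>a\<bar> + \<bar>b\<bar>" using c by cases (simp_all add: nbr_vec_def)
    then show ?thesis using n(2) by linarith
  qed
  have "pass k (ray p k t)" for t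
  proof -
    let ?t = "t mod \<bar>c\<bar>"
    have "0 \<le> ?t" "?t < \<bar>c\<bar>" using c0 by simp_all
    then have "nat ?t < n" using cn by linarith
    then have "pass k (ray p k (int (nat ?t)))" using st unfolding straight_def by blast
    then have "pass k (ray p k ?t)" unfolding nat_0_le[OF \<open>0 \<le> ?t\<close>] .
    moreover have "tc a b (ray p k ?t) = tc a b (ray p k t)"
    proof -
      have t: "t = ?t + (t div \<bar>c\<bar> * sgn c) * c" by (simp add: mult.assoc sgn_mult_self_eq mult.commute[of "sgn c"] abs_sgn[symmetric])
      show ?thesis unfolding tc_eq_iff ray_def
        by (rule exI[of _ "t div \<bar>c\<bar> * sgn c"], subst (1 2) t) (simp add: c algebra_simps)
    qed
    ultimately show ?thesis using pass_shift by blast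
  qed
  then show ?thesis using that c by blast
qed

context
  fixes k :: nat and c :: int and p :: cell
  assumes k: "even k" and c: "a = c * fst (nbr_vec k)" "b = c * snd (nbr_vec k)"
    and row: "\<And>t. pass k (ray p k t)"
begin

abbreviation (input) "row_cell t \<equiv> ray p k t"

lemma row_period: "tc a b (row_cell s) = tc a b (row_cell t) \<longleftrightarrow> (\<exists>z. t = s + z * c)"
proof
  assume "tc a b (row_cell s) = tc a b (row_cell t)"
  then obtain z where "fst (row_cell t) = fst (row_cell s) + z * a" "snd (row_cell t) = snd (row_cell s) + z * b"
    unfolding tc_eq_iff by blast
  then have "(t - s - z * c) * fst (nbr_vec k) = 0" "(t - s - z * c) * snd (nbr_vec k) = 0"
    unfolding ray_def c by (simp_all add: algebra_simps)
  then have "t - s - z * c = 0" using nbr_vec_small(4)[of k] by auto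
  then show "\<exists>z. t = s + z * c" by (intro exI[of _ z]) simp
next
  assume "\<exists>z. t = s + z * c"
  then obtain z where "t = s + z * c" by blast
  then show "tc a b (row_cell s) = tc a b (row_cell t)"
    unfolding tc_eq_iff ray_def by (intro exI[of _ z]) (simp add: c algebra_simps)
qed

lemma circumference: "2 \<le> \<bar>c\<bar>"
proof -
  have "c \<noteq> 0" using c nonzero by auto
  moreover have "c \<noteq> 1" using c nonshort[of k] by auto
  moreover have "c \<noteq> -1"
  proof
    assume "c = -1"
    then have "(a, b) = (- fst (nbr_vec k), - snd (nbr_vec k))" using c by simp
    also have "\<dots> = nbr_vec (k + 3)" by (cases rule: residue_6[of k]) (simp_all add: nbr_vec_def)
    finally show False using nonshort by blast
  qed
  ultimately show ?thesis by linarith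
qed

lemma row_hex: "tc a b (row_cell t) \<in> hexes"
  using row[of t] S_hex by (simp add: pass_def)

lemma row_white: "ind M (row_cell (t + 1)) (k + 2) + ind M (row_cell t) (k + 1) = 1"
  using hex_sum[OF M row_hex, of t k] row[of t] unfolding ray_nbr pass_def not_in_iff_ind by simp

lemma row_black: "ind M (row_cell t) (k + 1) + ind M (nbr (row_cell t) (k + 1)) (k + 3) + ind M (row_cell t) (k + 2) = 1"
proof -
  have e: "k + 1 + 1 = k + 2" "k + 1 + 2 = k + 3" by simp_all
  show ?thesis using hex_sum[OF M row_hex, of t "k + 1"] unfolding e by linarith
qed

text \<open>
  To the left of the row, the vertices at the corners \<open>k + 1\<close> are not matched across the row. Each
  of them must be matched to one of its two neighbours on the zigzag line that bounds the row. If one is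
  matched forwards, its forward neighbour is taken and the next one has to be matched forwards, too;
  around the cylinder all of them follow. Hence the line is alternating and no matched edge leaves it.
\<close>
lemma row_alternates:
  "ind M (row_cell (t + 1)) (k + 2) = ind M (row_cell t) (k + 2)"
  "ind M (nbr (row_cell t) (k + 1)) (k + 3) = 0"
proof -
  have step: "ind M (row_cell t) (k + 2) \<le> ind M (row_cell (t + 1)) (k + 2)" for t
    using row_white[of t] row_black[of t] ind_bounds(1)[of M "nbr (row_cell t) (k + 1)" "k + 3"] by linarith
  have mono: "ind M (row_cell t) (k + 2) \<le> ind M (row_cell (t + int m)) (k + 2)" for t m
  proof (induction m)
    case (Suc m)
    then show ?case using step[of "t + int m"] by (simp add: add.assoc add.commute[of 1])
  qed simp
  have "\<exists>z. t = t + \<bar>c\<bar> + z * c" by (rule exI[of _ "- sgn c"]) (simp add: abs_sgn mult.commute)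
  then have "ind M (row_cell (t + \<bar>c\<bar>)) (k + 2) = ind M (row_cell t) (k + 2)"
    by (intro ind_shift) (simp only: row_period)
  moreover have c1: "t + 1 + int (nat (\<bar>c\<bar> - 1)) = t + \<bar>c\<bar>" using circumference by linarith
  ultimately show eq: "ind M (row_cell (t + 1)) (k + 2) = ind M (row_cell t) (k + 2)"
    using step[of t] mono[of "t + 1" "nat (\<bar>c\<bar> - 1)"] unfolding c1 by linarith
  show "ind M (nbr (row_cell t) (k + 1)) (k + 3) = 0"
    using row_white[of t] row_black[of t] eq by linarith
qed

text \<open>
  The zigzag line on the left of the row, read in the direction of the row: the corner \<open>k + 2\<close> of a
  cell, its corner \<open>k + 1\<close>, the corner \<open>k + 2\<close> of the next cell, and so on.
\<close>
definition zig :: "nat \<Rightarrow> tvert" where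
  "zig i = (if even i then tv a b (corner (row_cell (int (i div 2))) (k + 2))
     else tv a b (corner (row_cell (int (i div 2))) (k + 1)))"

definition zig_edge :: "nat \<Rightarrow> tedge" where
  "zig_edge i = (if even i then tside a b (row_cell (int (i div 2))) (k + 1)
     else tside a b (row_cell (int (i div 2) + 1)) (k + 2))"

lemma zig_edge: "{zig i, zig (Suc i)} = zig_edge i"
proof (cases "even i")
  case True
  then show ?thesis by (simp add: zig_def zig_edge_def tside_def insert_commute del: corner.simps)
next
  case False
  let ?t = "int (i div 2)"
  have "corner (row_cell (?t + 1)) (Suc (k + 2)) = corner (row_cell ?t) (k + 1)"
    using corner_nbr[of "row_cell ?t" k] unfolding ray_nbr by (simp add: numeral_eq_Suc)
  moreover have "Suc i div 2 = Suc (i div 2)" using False by presburger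
  ultimately show ?thesis using False
    by (simp add: zig_def zig_edge_def tside_def insert_commute add.commute del: corner.simps)
qed

lemma zig_period: "zig (i mod (2 * nat \<bar>c\<bar>)) = zig i"
proof -
  let ?n = "nat \<bar>c\<bar>"
  have "i = i mod (2 * ?n) + 2 * (?n * (i div (2 * ?n)))" by (simp add: mult.assoc[symmetric])
  then obtain r z where i: "i = r + 2 * (?n * z)" and r: "r = i mod (2 * ?n)" by blast
  have "i div 2 = r div 2 + ?n * z" unfolding i by simp
  then have "int (i div 2) = int (r div 2) + (int z * sgn c) * c"
    using circumference by (simp add: abs_sgn algebra_simps)
  then have "tc a b (row_cell (int (r div 2))) = tc a b (row_cell (int (i div 2)))" unfolding row_period by blast
  moreover have "even i \<longleftrightarrow> even r" unfolding i by simp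
  ultimately show ?thesis unfolding r[symmetric] zig_def by (metis tv_corner_shift)
qed

lemma zig_inj: "inj_on zig {..<2 * nat \<bar>c\<bar>}"
proof (rule inj_onI)
  fix i j assume i: "i \<in> {..<2 * nat \<bar>c\<bar>}" and j: "j \<in> {..<2 * nat \<bar>c\<bar>}" and eq: "zig i = zig j"
  have par: "even i \<longleftrightarrow> even j"
    using eq tv_corner_parity[of "k + 2" "k + 1"] k unfolding zig_def by (metis even_Suc even_add even_numeral Suc_eq_plus1)
  then have "tc a b (row_cell (int (i div 2))) = tc a b (row_cell (int (j div 2)))"
    using eq unfolding zig_def by (simp add: tv_corner_iff del: corner.simps split: if_splits)
  then obtain z where z: "int (j div 2) = int (i div 2) + z * c" unfolding row_period by blast
  have "\<bar>int (j div 2) - int (i div 2)\<bar> < \<bar>c\<bar>" using i j by auto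
  then have "\<bar>z\<bar> * \<bar>c\<bar> < 1 * \<bar>c\<bar>" unfolding z by (simp add: abs_mult)
  then have "z = 0" using circumference by (simp only: mult_less_cancel_right) auto
  then have "i div 2 = j div 2" using z by simp
  then show "i = j" using par by (metis div_mult_mod_eq parity_cases)
qed

lemma row_zigzag:
  defines "Z \<equiv> map zig [0..<2 * nat \<bar>c\<bar>]"
  shows "zigzag_cycle a b edges Z" "alternating M Z" "cyc_edge Z i = zig_edge i"
proof -
  have len: "length Z = 2 * nat \<bar>c\<bar>" by (simp add: Z_def)
  have pos: "0 < length Z" using circumference unfolding len by simp
  have nth: "Z ! (i mod length Z) = zig i" for i
  proof -
    have "i mod length Z < length Z" using pos by simp
    then have "Z ! (i mod length Z) = zig (i mod length Z)" by (simp add: Z_def)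
    then show ?thesis using zig_period unfolding len by simp
  qed
  show edge: "cyc_edge Z i = zig_edge i" for i unfolding cyc_edge_def nth zig_edge ..
  have "zig_edge i \<in> edges" for i unfolding zig_edge_def using hex_sides[OF row_hex] by simp
  then have "is_cycle edges Z"
    using circumference zig_inj unfolding is_cycle_def cyc_edges_def edge len
    by (auto simp: Z_def distinct_map atLeast0LessThan)
  moreover have "has_direction a b (zig_edge i) (if even i then (k + 1) mod 3 else (k + 2) mod 3)" for i
    unfolding zig_edge_def using has_direction_side by simp
  ultimately show "zigzag_cycle a b edges Z"
    unfolding zigzag_cycle_def edge using residues_3(3)[of k] len by (metis dvd_triv_left)
  have "zig_edge i \<in> M \<longleftrightarrow> zig_edge (Suc i) \<notin> M" for i
  proof -
    let ?t = "int (i div 2)"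
    have "ind M (row_cell (?t + 1)) (k + 2) + ind M (row_cell ?t) (k + 1) = 1"
      "ind M (row_cell (?t + 1)) (k + 1) + ind M (row_cell (?t + 1)) (k + 2) = 1"
      using row_white[of ?t] row_black[of "?t + 1"] row_alternates(2)[of "?t + 1"] by linarith+
    moreover have "even i \<Longrightarrow> Suc i div 2 = i div 2" "odd i \<Longrightarrow> Suc i div 2 = Suc (i div 2)" by presburger+
    ultimately show ?thesis
      unfolding zig_edge_def ind_def by (auto simp: add.commute split: if_splits)
  qed
  then show "alternating M Z" unfolding alternating_def edge by blast
qed

text \<open>
  The zigzag line is a ladder of \<open>M\<close>, hence also of \<open>M'\<close> with the same matched edges. So the cells
  beyond it are in \<open>S\<close>, and the edges between them are unmatched because all vertices of the line
  are matched inside it.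
\<close>
lemma next_row: "pass k (ray (nbr p (k + 1)) k t)"
proof -
  let ?Z = "map zig [0..<2 * nat \<bar>c\<bar>]"
  have same: "M \<inter> cyc_edges ?Z = M' \<inter> cyc_edges ?Z"
    using ladders row_zigzag(1,2) unfolding same_ladders_def by blast
  have "zig_edge (2 * nat (t mod \<bar>c\<bar>)) \<in> cyc_edges ?Z"
    using cyc_edge_in[of ?Z "2 * nat (t mod \<bar>c\<bar>)"] circumference unfolding row_zigzag(3) by simp
  moreover have "zig_edge (2 * nat (t mod \<bar>c\<bar>)) = tside a b (row_cell t) (k + 1)"
  proof -
    have "t mod \<bar>c\<bar> \<ge> 0" using circumference by simp
    then have "zig_edge (2 * nat (t mod \<bar>c\<bar>)) = tside a b (row_cell (t mod \<bar>c\<bar>)) (k + 1)"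
      by (simp add: zig_edge_def)
    moreover have "\<exists>z. t = t mod \<bar>c\<bar> + z * c"
    proof
      have "t = t mod \<bar>c\<bar> + t div \<bar>c\<bar> * \<bar>c\<bar>" by simp
      then show "t = t mod \<bar>c\<bar> + (t div \<bar>c\<bar> * sgn c) * c"
        by (simp only: abs_sgn mult.assoc mult.commute[of "sgn c"])
    qed
    then have "tc a b (row_cell (t mod \<bar>c\<bar>)) = tc a b (row_cell t)" unfolding row_period .
    then have "tside a b (row_cell (t mod \<bar>c\<bar>)) (k + 1) = tside a b (row_cell t) (k + 1)" by (rule tside_shift)
    ultimately show ?thesis by simp
  qed
  ultimately have "tside a b (row_cell t) (k + 1) \<in> cyc_edges ?Z" by simp
  then have "tside a b (row_cell t) (k + 1) \<in> M \<longleftrightarrow> tside a b (row_cell t) (k + 1) \<in> M'" using same by blast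
  then have "nbr (row_cell t) (k + 1) \<in> S" using row[of t] S_agree[of "row_cell t" "k + 1"] unfolding pass_def by blast
  moreover have row_eq: "nbr (row_cell t) (k + 1) = ray (nbr p (k + 1)) k t" for t
    unfolding nbr_ray by (rule ray_commute)
  moreover have "nbr (row_cell (t + 1)) (k + 1) = nbr (ray (nbr p (k + 1)) k t) k"
    by (simp only: row_eq ray_nbr)
  then have "ind M (ray (nbr p (k + 1)) k t) k = 0"
    using row_alternates(2)[of "t + 1"] ind_nbr[of M "ray (nbr p (k + 1)) k t" k] by simp
  ultimately show ?thesis unfolding pass_def not_in_iff_ind by simp
qed

end

text \<open>
  Row after row would belong to \<open>S\<close>, but the nanotube is finite.
\<close>
lemma no_passable_row:
  assumes k: "even k" and c: "a = c * fst (nbr_vec k)" "b = c * snd (nbr_vec k)"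
    and row: "\<And>t. pass k (ray p k t)"
  shows False
proof -
  have rows: "\<forall>t. pass k (ray (ray p (k + 1) (int s)) k t)" for s
  proof (induction s)
    case (Suc s)
    then have "\<forall>t. pass k (ray (nbr (ray p (k + 1) (int s)) (k + 1)) k t)"
      using next_row[OF k c] by blast
    then show ?case unfolding ray_nbr by (simp add: add.commute)
  qed (use row in simp)
  have "inj (\<lambda>s. tc a b (ray p (k + 1) (int s)))"
  proof (rule injI)
    fix s t assume "tc a b (ray p (k + 1) (int s)) = tc a b (ray p (k + 1) (int t))"
    then obtain n where "fst (ray p (k + 1) (int t)) = fst (ray p (k + 1) (int s)) + n * a"
      "snd (ray p (k + 1) (int t)) = snd (ray p (k + 1) (int s)) + n * b"
      unfolding tc_eq_iff by blast
    then have "(int t - int s) * fst (nbr_vec (k + 1)) = n * c * fst (nbr_vec k)"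
      "(int t - int s) * snd (nbr_vec (k + 1)) = n * c * snd (nbr_vec k)"
      unfolding c by (simp_all add: ray_def left_diff_distrib)
    then show "s = t" by (cases rule: residue_6[of k]) (auto simp: nbr_vec_def)
  qed
  then have "infinite (range (\<lambda>s. tc a b (ray p (k + 1) (int s))))" using finite_imageD by blast
  moreover have "ray p (k + 1) (int s) \<in> S" for s
    using rows[of s, THEN spec, of 0] by (simp add: pass_def)
  then have "range (\<lambda>s. tc a b (ray p (k + 1) (int s))) \<subseteq> tc a b ` S" by blast
  ultimately show False using finite_S_cells finite_subset by blast
qed

text \<open>
  Otherwise every cell of \<open>S\<close> has a passable even side, there are passable walks of any length in \<open>S\<close>,
  and sorting one of them produces a passable row.
\<close>
lemma flippable_hexagon:
  assumes "S \<noteq> {}"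
  shows "\<exists>p\<in>S. \<forall>k\<in>{0, 2, 4}. tside a b p k \<in> M"
proof (rule ccontr)
  assume "\<not> ?thesis"
  then have move: "\<exists>k\<in>{0, 2, 4}. tside a b p k \<notin> M" if "p \<in> S" for p
    using that by blast
  obtain p where p: "p \<in> S" using assms by blast
  \<comment> \<open>long enough to revisit a cell, and to run once around the cylinder\<close>
  define n where "n = Suc (card (tc a b ` S)) + nat (\<bar>a\<bar> + \<bar>b\<bar>)"
  obtain f where f: "f 0 + f 2 + f 4 = 3 * n" "\<forall>j\<in>{0, 2, 4}. straight j (f j) p"
    using straight_runs[OF move p, of "3 * n"] by blast
  have "n \<le> f 0 \<or> n \<le> f 2 \<or> n \<le> f 4" using f(1) by linarith
  then obtain k where k: "k \<in> {0, 2, 4}" "n \<le> f k" by blast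
  then have "straight k (f k) p" using f(2) by blast
  then have "straight k n p" using k(2) by (auto simp: straight_def)
  moreover have "card (tc a b ` S) < n" "\<bar>a\<bar> + \<bar>b\<bar> \<le> int n" by (simp_all add: n_def)
  ultimately obtain c where "a = c * fst (nbr_vec k)" "b = c * snd (nbr_vec k)" "\<And>t. pass k (ray p k t)"
    using straight_row[OF k(1)] by blast
  then show False using no_passable_row[of k c p] k(1) by auto
qed

end
end

section \<open>Connecting two matchings by flips\<close>

context coloured_nanotube
begin

lemma side_sign_alternates: "tc a b p \<in> hexes \<Longrightarrow> side_sign p k = (-1) ^ k * side_sign p 0"
  by (induction k) (use side_sign_Suc[OF hex_sides] in simp_all)

lemma side_sign_hex_nbr:
  assumes "tc a b p \<in> hexes" "tc a b (nbr p k) \<in> hexes"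
  shows "side_sign (nbr p k) 0 = side_sign p 0"
proof -
  have "(-1) ^ (k + 3) * side_sign (nbr p k) 0 = - ((-1) ^ k * side_sign p 0)"
    using side_sign_nbr[OF hex_sides[OF assms(1)], of k] side_sign_alternates[OF assms(1), of k]
      side_sign_alternates[OF assms(2), of "k + 3"] by simp
  then show ?thesis by (simp add: power_add)
qed

lemma side_sign_cases: "side_sign p k = 1 \<or> side_sign p k = -1"
  by (simp add: side_sign_def)

lemma potential_swap:
  assumes "potential M M' h"
  shows "potential M' M (\<lambda>p. - h p)"
proof -
  have "- h (nbr p k) = - h p + jump M' M p k" for p k
  proof -
    have "h (nbr p k) = h p + jump M M' p k" using assms unfolding potential_def by blast
    moreover have "jump M' M p k = - jump M M' p k" by (simp add: jump_def right_diff_distrib)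
    ultimately show ?thesis by linarith
  qed
  then show ?thesis using assms unfolding potential_def by metis
qed

lemma potential_trans:
  assumes g: "potential M M' g" and h: "potential M' M'' h"
  shows "potential M M'' (\<lambda>p. g p + h p)"
proof -
  have "g (nbr p k) + h (nbr p k) = g p + h p + jump M M'' p k" for p k
  proof -
    have "g (nbr p k) = g p + jump M M' p k" "h (nbr p k) = h p + jump M' M'' p k"
      using g h unfolding potential_def by blast+
    moreover have "jump M M'' p k = jump M M' p k + jump M' M'' p k" by (simp add: jump_def right_diff_distrib)
    ultimately show ?thesis by linarith
  qed
  then show ?thesis using g h unfolding potential_def by metis
qed

lemma potential_zero_eq:
  assumes M: "pmatching M" "pmatching M'" and h: "potential M M' h" and 0: "\<And>p. h p = 0"
  shows "M = M'"
proof -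
  have eq: "tside a b p k \<in> M \<longleftrightarrow> tside a b p k \<in> M'" for p k
  proof -
    have "h (nbr p k) = h p + jump M M' p k" using h unfolding potential_def by blast
    then have "jump M M' p k = 0" unfolding 0 by simp
    then have "ind M p k = ind M' p k" using side_sign_cases[of p k] by (auto simp: jump_def)
    then show ?thesis by (auto simp: ind_def of_bool_def split: if_splits)
  qed
  have sub: "M \<subseteq> tube_edges a b" "M' \<subseteq> tube_edges a b"
    using M edges_tube by (auto simp: perfect_matching_def)
  have "e \<in> M \<longleftrightarrow> e \<in> M'" if e: "e \<in> tube_edges a b" for e
  proof -
    obtain p k where "e = tside a b p k" using e unfolding tube_edges_def by blast
    then show ?thesis using eq by simp
  qed
  then show ?thesis using sub by blast
qed

text \<open>
  On the set where the potential is maximal, a step with a jump that is not negative stays in the set.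
  If white is on the left across even sides, these are the even sides that \<open>M\<close> misses; otherwise they
  are the even sides that \<open>M'\<close> misses. Which case applies is known to be the same only for
  neighbouring hexagons, so \<open>S\<close> keeps to the hexagons of one type.
\<close>
lemma flip_towards:
  assumes M: "pmatching M" "pmatching M'" and lad: "same_ladders a b edges M M'"
    and h: "potential M M' h" and off: "\<And>p. tc a b p \<notin> hexes \<Longrightarrow> h p = 0"
    and pos: "h p0 > 0"
  obtains p where "h p > 0" "side_sign p 0 = 1" "\<forall>k\<in>{0, 2, 4}. tside a b p k \<in> M"
    | p where "h p > 0" "side_sign p 0 = -1" "\<forall>k\<in>{0, 2, 4}. tside a b p k \<in> M'"
proof -
  have shift: "h p = h q" if "tc a b p = tc a b q" for p q
    using h that unfolding potential_def by blast
  have step: "h (nbr p k) = h p + jump M M' p k" for p k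
    using h unfolding potential_def by blast
  have "finite (h ` {p. tc a b p \<in> hexes})"
  proof -
    define g where "g P = h (SOME p. tc a b p = P)" for P
    have "h p = g (tc a b p)" for p
      unfolding g_def by (rule shift) (metis (mono_tags, lifting) someI)
    then have "h ` {p. tc a b p \<in> hexes} \<subseteq> g ` hexes" by auto
    then show ?thesis using finite_hexes finite_subset by blast
  qed
  then have fin: "finite (insert 0 (h ` {p. tc a b p \<in> hexes}))" by simp
  define m where "m = Max (insert 0 (h ` {p. tc a b p \<in> hexes}))"
  have le: "h p \<le> m" for p
  proof -
    have "h p \<in> insert 0 (h ` {p. tc a b p \<in> hexes})" using off[of p] by blast
    then show ?thesis unfolding m_def using fin by (rule Max_ge[rotated])
  qed
  then have m0: "m > 0" using pos by (metis less_le_trans)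
  have "m \<in> insert 0 (h ` {p. tc a b p \<in> hexes})" unfolding m_def using fin by (rule Max_in) simp
  then obtain p1 where p1: "h p1 = m" using m0 by auto
  have hex: "tc a b p \<in> hexes" if "h p = m" for p using that off m0 by fastforce
  define S where "S = {p. h p = m \<and> side_sign p 0 = side_sign p1 0}"
  have up: "nbr p k \<in> S" if p: "p \<in> S" and d: "jump M M' p k \<ge> 0" for p k
  proof -
    have "h (nbr p k) = m" using step[of p k] le[of "nbr p k"] d p by (simp add: S_def)
    moreover have "side_sign (nbr p k) 0 = side_sign p 0"
      using side_sign_hex_nbr hex p \<open>h (nbr p k) = m\<close> unfolding S_def by blast
    ultimately show ?thesis using p unfolding S_def by simp
  qed
  have S_hex: "tc a b p \<in> hexes" if "p \<in> S" for p using hex that by (simp add: S_def)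
  have S_shift: "q \<in> S" if "p \<in> S" "tc a b p = tc a b q" for p q
    using that shift side_sign_shift unfolding S_def by (metis (mono_tags, lifting) mem_Collect_eq)
  have agree: "nbr p k \<in> S" if "p \<in> S" "tside a b p k \<in> M \<longleftrightarrow> tside a b p k \<in> M'" for p k
    using up[OF that(1)] that(2) by (simp add: jump_def ind_def)
  have ne: "S \<noteq> {}" using p1 unfolding S_def by blast
  have even: "side_sign p k = side_sign p1 0" if "p \<in> S" "even k" for p k
    using side_sign_alternates[OF S_hex[OF that(1)], of k] that by (simp add: S_def)
  show thesis
  proof (cases "side_sign p1 0 = 1")
    case True
    have move: "nbr p k \<in> S" if "p \<in> S" "even k" "tside a b p k \<notin> M" for p k
      using up[OF that(1), of k] even[OF that(1,2)] True that(3) by (simp add: jump_def ind_def)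
    have "\<exists>p\<in>S. \<forall>k\<in>{0, 2, 4}. tside a b p k \<in> M"
      by (rule flippable_hexagon[where S = S and M' = M', OF M(1)])
        (fact S_hex S_shift move agree lad ne)+
    then obtain p where "p \<in> S" "\<forall>k\<in>{0, 2, 4}. tside a b p k \<in> M" by blast
    then show ?thesis using that(1)[of p] m0 True by (simp add: S_def)
  next
    case False
    then have s: "side_sign p1 0 = -1" using side_sign_cases by blast
    have move: "nbr p k \<in> S" if "p \<in> S" "even k" "tside a b p k \<notin> M'" for p k
      using up[OF that(1), of k] even[OF that(1,2)] s that(3) by (simp add: jump_def ind_def)
    have "\<exists>p\<in>S. \<forall>k\<in>{0, 2, 4}. tside a b p k \<in> M'"
      by (rule flippable_hexagon[where S = S and M' = M, OF M(2)])
        (fact S_hex S_shift move agree[OF _ sym] same_ladders_sym[OF lad] ne)+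
    then obtain p where "p \<in> S" "\<forall>k\<in>{0, 2, 4}. tside a b p k \<in> M'" by blast
    then show ?thesis using that(2)[of p] m0 s by (simp add: S_def)
  qed
qed

lemma R6_adj_potential:
  assumes "pmatching M" "tc a b p \<in> hexes" "\<forall>k\<in>{0, 2, 4}. tside a b p k \<in> M"
  obtains M' where "pmatching M'" "(M, M') \<in> R6_adj a b C1 C2"
    "potential M M' (\<lambda>q. side_sign p 0 * of_bool (tc a b q = tc a b p))"
proof -
  let ?P = "{tside a b p k |k. k < 6}"
  let ?M = "(M - ?P) \<union> (?P - M)"
  have M: "pmatching ?M" "(M, ?M) \<in> R6_adj a b C1 C2"
    using flip_matching[OF assms(1,2)] assms(3) by blast+
  have "(M - ?M) \<union> (?M - M) = ?P" by blast
  from flip_potential[OF assms(1) M(1) this]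
  have pot: "potential M ?M (\<lambda>q. - jump M ?M p 0 * of_bool (tc a b q = tc a b p))" .
  have "tside a b p 0 \<in> ?P" unfolding mem_Collect_eq by (rule exI[of _ 0]) simp
  then have "jump M ?M p 0 = - side_sign p 0" using assms(3) by (simp add: jump_def ind_def)
  then show ?thesis using that[OF M] pot by simp
qed

text \<open>
  Induction on the sum of the absolute values of the potential: where it is positive, a flip of \<open>M\<close>
  or of \<open>M'\<close> lowers it by one at a single hexagon.
\<close>
lemma same_ladders_connected:
  assumes "pmatching M" "pmatching M'" "same_ladders a b edges M M'"
    and "potential M M' h" "\<And>p. tc a b p \<notin> hexes \<Longrightarrow> h p = 0"
  shows "(M, M') \<in> (R6_adj a b C1 C2)\<^sup>*"
proof -
  define rep where "rep P = (SOME p. tc a b p = P)" for P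
  have rep: "tc a b (rep (tc a b p)) = tc a b p" for p
    unfolding rep_def by (metis (mono_tags, lifting) someI)
  have sym: "(M, M') \<in> (R6_adj a b C1 C2)\<^sup>* \<Longrightarrow> (M', M) \<in> (R6_adj a b C1 C2)\<^sup>*" for M M'
    using sym_rtrancl[OF symI[of "R6_adj a b C1 C2"]] R6_adj_sym by (metis symD)
  define size where "size h = (\<Sum>P\<in>hexes. nat \<bar>h (rep P)\<bar>)" for h :: "cell \<Rightarrow> int"
  have smaller: "size g < size h"
    if p: "tc a b p \<in> hexes" and h: "\<And>q. tc a b q = tc a b p \<Longrightarrow> h q > 0"
      and g: "\<And>q. g q = h q - of_bool (tc a b q = tc a b p)" for g h p
    unfolding size_def
  proof (rule sum_strict_mono_ex1[OF finite_hexes])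
    show "\<forall>P\<in>hexes. nat \<bar>g (rep P)\<bar> \<le> nat \<bar>h (rep P)\<bar>"
    proof
      fix P
      show "nat \<bar>g (rep P)\<bar> \<le> nat \<bar>h (rep P)\<bar>"
        using h[of "rep P"] g[of "rep P"] by (cases "tc a b (rep P) = tc a b p") auto
    qed
    show "\<exists>P\<in>hexes. nat \<bar>g (rep P)\<bar> < nat \<bar>h (rep P)\<bar>"
      using p h[OF rep] g[of "rep (tc a b p)"] rep by (intro bexI[of _ "tc a b p"]) auto
  qed
  show ?thesis
    using assms
  proof (induction "size h" arbitrary: M M' h rule: less_induct)
    case less
    note M = less.prems(1,2) and lad = less.prems(3) and pot = less.prems(4) and off = less.prems(5)
    have shift: "h p = h q" if "tc a b p = tc a b q" for p q
      using pot that unfolding potential_def by blast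
    \<comment> \<open>both signs of the potential are treated by the same argument\<close>
    have main: "(N, N') \<in> (R6_adj a b C1 C2)\<^sup>*"
      if N: "pmatching N" "pmatching N'" and lad: "same_ladders a b edges N N'"
        and pot: "potential N N' f" and off: "\<And>p. tc a b p \<notin> hexes \<Longrightarrow> f p = 0"
        and size: "size f = size h" and pos: "f p0 > 0" for N N' f p0
    proof -
      have shift: "f p = f q" if "tc a b p = tc a b q" for p q
        using pot that unfolding potential_def by blast
      consider p where "f p > 0" "side_sign p 0 = 1" "\<forall>k\<in>{0, 2, 4}. tside a b p k \<in> N"
        | p where "f p > 0" "side_sign p 0 = -1" "\<forall>k\<in>{0, 2, 4}. tside a b p k \<in> N'"
        using flip_towards[OF N lad pot off pos] by metis
      then show ?thesis
      proof cases
        case 1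
        let ?g = "\<lambda>q. f q - of_bool (tc a b q = tc a b p)"
        have p: "tc a b p \<in> hexes" using off[of p] 1(1) by fastforce
        obtain M1 where M1: "pmatching M1" "(N, M1) \<in> R6_adj a b C1 C2"
          "potential N M1 (\<lambda>q. side_sign p 0 * of_bool (tc a b q = tc a b p))"
          using R6_adj_potential[OF N(1) p 1(3)] .
        have "potential M1 N' (\<lambda>q. - (side_sign p 0 * of_bool (tc a b q = tc a b p)) + f q)"
          by (rule potential_trans[OF potential_swap[OF M1(3)] pot])
        moreover have "(\<lambda>q. - (side_sign p 0 * of_bool (tc a b q = tc a b p)) + f q) = ?g"
          by (rule ext) (simp add: 1(2))
        ultimately have g: "potential M1 N' ?g" by simp
        have "size ?g < size h"
          unfolding size[symmetric]
        proof (rule smaller[OF p])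
          show "f q > 0" if "tc a b q = tc a b p" for q using 1(1) unfolding shift[OF that] .
        qed (rule refl)
        moreover have "same_ladders a b edges M1 N'"
          using same_ladders_trans[OF same_ladders_sym[OF R6_adj_same_ladders[OF M1(2)]] lad] .
        moreover have "?g q = 0" if "tc a b q \<notin> hexes" for q using off[OF that] p that by auto
        ultimately have "(M1, N') \<in> (R6_adj a b C1 C2)\<^sup>*" using less.hyps[OF _ M1(1) N(2) _ g] by blast
        then show ?thesis using M1(2) by (rule converse_rtrancl_into_rtrancl[rotated])
      next
        case 2
        let ?g = "\<lambda>q. f q - of_bool (tc a b q = tc a b p)"
        have p: "tc a b p \<in> hexes" using off[of p] 2(1) by fastforce
        obtain M1 where M1: "pmatching M1" "(N', M1) \<in> R6_adj a b C1 C2"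
          "potential N' M1 (\<lambda>q. side_sign p 0 * of_bool (tc a b q = tc a b p))"
          using R6_adj_potential[OF N(2) p 2(3)] .
        have "potential N M1 (\<lambda>q. f q + side_sign p 0 * of_bool (tc a b q = tc a b p))"
          by (rule potential_trans[OF pot M1(3)])
        moreover have "(\<lambda>q. f q + side_sign p 0 * of_bool (tc a b q = tc a b p)) = ?g"
          by (rule ext) (simp add: 2(2))
        ultimately have g: "potential N M1 ?g" by simp
        have "size ?g < size h"
          unfolding size[symmetric]
        proof (rule smaller[OF p])
          show "f q > 0" if "tc a b q = tc a b p" for q using 2(1) unfolding shift[OF that] .
        qed (rule refl)
        moreover have "same_ladders a b edges N M1"
          using same_ladders_trans[OF lad R6_adj_same_ladders[OF M1(2)]] .
        moreover have "?g q = 0" if "tc a b q \<notin> hexes" for q using off[OF that] p that by auto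
        ultimately have "(N, M1) \<in> (R6_adj a b C1 C2)\<^sup>*" using less.hyps[OF _ N(1) M1(1) _ g] by blast
        then show ?thesis using R6_adj_sym[OF M1(2)] by (rule rtrancl_into_rtrancl)
      qed
    qed
    show ?case
    proof (cases "\<forall>p. h p = 0")
      case True
      then have "M = M'" using potential_zero_eq[OF M pot] by blast
      then show ?thesis by simp
    next
      case False
      then obtain p where "h p > 0 \<or> - h p > 0" by (metis linorder_cases neg_0_less_iff_less)
      then show ?thesis
      proof
        assume "h p > 0"
        then show ?thesis using main[OF M lad pot off refl] by blast
      next
        assume "- h p > 0"
        moreover have "size (\<lambda>p. - h p) = size h" by (simp add: size_def)
        ultimately have "(M', M) \<in> (R6_adj a b C1 C2)\<^sup>*"
          using main[OF M(2,1) same_ladders_sym[OF lad] potential_swap[OF pot]] off by simp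
        then show ?thesis by (rule sym)
      qed
    qed
  qed
qed

end

context cut_nanotube
begin

text \<open>
  The potential of a flip vanishes on the two end faces.
\<close>
lemma R6_adj_flow:
  assumes "(M, M') \<in> R6_adj a b C1 C2"
  shows "flow a b col L M = flow a b col L M'"
proof -
  obtain p where M: "pmatching M" "pmatching M'" and p: "tc a b p \<in> hexes"
    and diff: "(M - M') \<union> (M' - M) = {tside a b p k |k. k < 6}"
    using assms unfolding R6_adj_def by blast
  have "tc a b (fst (hd L)) \<noteq> tc a b p" "tc a b (nbr (fst (last L)) (snd (last L))) \<noteq> tc a b p"
    using cut_ends_not_hex p by metis+
  then show ?thesis
    using flow_potential[OF M flip_potential[OF M diff]] by (simp del: nbr.simps)
qed

lemma component_iff:
  assumes M: "pmatching M" "pmatching M'"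
  shows "same_R6_component a b C1 C2 M M' \<longleftrightarrow>
    flow a b col L M = flow a b col L M' \<and> same_ladders a b edges M M'"
proof
  assume "same_R6_component a b C1 C2 M M'"
  then have "(M, M') \<in> (R6_adj a b C1 C2)\<^sup>*" by (simp add: same_R6_component_def)
  then show "flow a b col L M = flow a b col L M' \<and> same_ladders a b edges M M'"
  proof (induction rule: rtrancl_induct)
    case base
    show ?case by (simp add: same_ladders_def)
  next
    case (step N N')
    then show ?case
      using R6_adj_flow[OF step(2)] same_ladders_trans[OF _ R6_adj_same_ladders[OF step(2)]] by simp
  qed
next
  assume eq: "flow a b col L M = flow a b col L M' \<and> same_ladders a b edges M M'"
  obtain h where h: "potential M M' h" using potential_exists[OF M] by blast
  let ?h = "\<lambda>p. h p - h (fst (hd L))"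
  have "?h (nbr p k) = ?h p + jump M M' p k" for p k
  proof -
    have "h (nbr p k) = h p + jump M M' p k" using h unfolding potential_def by blast
    then show ?thesis by linarith
  qed
  then have pot: "potential M M' ?h" using h unfolding potential_def by metis
  have "h (nbr (fst (last L)) (snd (last L))) = h (fst (hd L))"
    using flow_potential[OF M h] eq by simp
  then have "?h p = 0" if "tc a b p \<notin> hexes" for p
    using potential_off_hexes[OF M h that] by auto
  then have "(M, M') \<in> (R6_adj a b C1 C2)\<^sup>*"
    using same_ladders_connected[OF M _ pot] eq by blast
  then show "same_R6_component a b C1 C2 M M'" using M by (simp add: same_R6_component_def)
qed

end

theorem theorem2p17:
  fixes a b :: int
    and C1 C2 :: "tvert list"
    and col :: "tvert \<Rightarrow> colour"
    and L :: "(cell \<times> nat) list"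
    and M1 M2 :: "tedge set"
  assumes "(a, b) \<noteq> (0, 0)"
    and "open_ends a b C1 C2"
    and "proper_colouring (nt_edges a b C1 C2) col"
    and "\<exists>M. nt_perfect_matching a b C1 C2 M"
    and "cut_segment a b C1 C2 L"
    and "nt_perfect_matching a b C1 C2 M1"
    and "nt_perfect_matching a b C1 C2 M2"
  shows "same_R6_component a b C1 C2 M1 M2 \<longleftrightarrow>
    flow a b col L M1 = flow a b col L M2 \<and>
    same_ladders a b (nt_edges a b C1 C2) M1 M2"
proof -
  have "is_cycle (tube_edges a b) C1" using assms(2) by (simp add: open_ends_def)
  then have "(a, b) \<noteq> nbr_vec k" for k using short_no_cycle by blast
  then interpret cut_nanotube a b C1 C2 col L
    using assms by unfold_locales
  show ?thesis using assms(6,7) by (rule component_iff)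
qed

end
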